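(* Let $t>s>0$ and let $\ell_n$ be a sequence of positive integers. (a) Suppose $f\in\bar\Sigma(\varepsilon,s,\ell_n)$ for some fixed $\varepsilon>0$. Then $$\inf_{g\in\Sigma(t)}\|f-g\|_\infty\ge c\,2^{-\ell_n s}$$ for some constant $c\equiv c(\varepsilon,B,s,t,K)>0$. Moreover, if $2^{-\ell_n s}/r_n(s)\to\infty$ as $n\to\infty$ (so in particular if $2^{\ell_n}\simeq(n/\log n)^{1/(2R+1)}$ with $R>s$), then, for every $L_0>0$, $$\bar\Sigma(\varepsilon,s,\ell_n)\subset\tilde\Sigma(s,L_0r_n(s))$$ for every $n\ge n_0(\varepsilon,B,s,t,L_0,K)$ large enough. (b) If $\ell_n$ is such that $2^{-\ell_n s}/r_n(s)\to\infty$ as $n\to\infty$ (so in particular if $2^{\ell_n}\simeq(n/\log n)^{1/(2R+1)}$ with $R>s$), then for all $L_0'>0$, $\varepsilon>0$ the set $$\tilde\Sigma(s,L_0'r_n(s))\setminus\bar\Sigma(\varepsilon,s,\ell_n)$$ is nonempty for every $n\ge n_0(s,t,K,B,L_0')$ large enough.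
   Context: $T=[0,1]$ or $T=\mathbb R$; $\|\cdot\|_\infty$ is the supremum norm on $T$; $B\ge1$. $\simeq$ denotes two-sided inequalities up to universal constants. Wavelets and Hölder norm: fix an $S$-regular Daubechies wavelet basis of $L^2(T)$, $S>t$ (boundary-corrected if $T=[0,1]$), with compactly supported, $S$ times continuously differentiable scaling functions $\phi_k$ and wavelets $\psi_k$, $\psi_{lk}=2^{l/2}\psi_k(2^l\cdot)$; if $T=\mathbb R$, $l\ge0$ (set $J_0=0$) and $k\in\mathbb Z$; if $T=[0,1]$, $l\ge J_0$, $k=1,\ldots,2^l$ for the $\psi_{lk}$ and $k=1,\ldots,N$ for the $\phi_k$. For bounded continuous $f$ put $\alpha_k(f)=\int f\phi_k$, $\beta_{lk}(f)=\int f\psi_{lk}$ and $\|f\|_{s,\infty}=\max\bigl(\sup_k|\alpha_k(f)|,\ \sup_{k,l}2^{l(s+1/2)}|\beta_{lk}(f)|\bigr)$. $K(x,y)=\sum_k\phi_k(x)\phi_k(y)$ is the projection kernel, and $K_j(f)=\sum_k\alpha_k(f)\phi_k+\sum_{l=J_0}^{j-1}\sum_k\beta_{lk}(f)\psi_{lk}$ is the partial sum of the wavelet series of $f$ at resolution level $j$. Classes: $\Sigma(s)=\Sigma(s,B,T)=\{f:T\to[0,\infty)\text{ bounded continuous},\ \int_T f=1,\ \|f\|_{s,\infty}\le B\}$; $\tilde\Sigma(s,\rho)=\{f\in\Sigma(s):\ \inf_{g\in\Sigma(t)}\|g-f\|_\infty\ge\rho\}$ for $\rho\ge0$; $\bar\Sigma(\varepsilon,s,\ell_n)=\{f\in\Sigma(s):\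 \varepsilon2^{-ls}\le\|K_l(f)-f\|_\infty\le B2^{-ls}\ \text{for all } l\ge\ell_n\}$. Rate: $r_n(s)=(\log n/n)^{s/(2s+1)}$. *)

theory Defs
  imports "HOL-Analysis.Analysis" "HOL-Library.Landau_Symbols"
begin

text \<open>
  Functions on \<open>T\<close>, where \<open>T = {0..1}\<close> or \<open>T = UNIV\<close>, are represented by functions
  on the whole real line; apart from the measurability in \<open>l2_function\<close>, every notion below that
  takes \<open>T\<close> as a parameter looks at the values on \<open>T\<close> only.
\<close>

section \<open>Orthonormal bases of \<open>L\<^sup>2(T)\<close>\<close>

definition l2_inner :: "real set \<Rightarrow> (real \<Rightarrow> real) \<Rightarrow> (real \<Rightarrow> real) \<Rightarrow> real" where
  "l2_inner T f g = (LINT x:T|lborel. f x * g x)"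

definition l2_function :: "real set \<Rightarrow> (real \<Rightarrow> real) \<Rightarrow> bool" where
  "l2_function T f \<longleftrightarrow>
     f \<in> borel_measurable borel \<and> set_integrable lborel T (\<lambda>x. (f x)\<^sup>2)"

definition orthonormal_family ::
    "real set \<Rightarrow> 'i set \<Rightarrow> ('i \<Rightarrow> real \<Rightarrow> real) \<Rightarrow> bool" where
  "orthonormal_family T I u \<longleftrightarrow>
     (\<forall>i\<in>I. l2_function T (u i)) \<and>
     (\<forall>i\<in>I. \<forall>j\<in>I. l2_inner T (u i) (u j) = (if i = j then 1 else 0))"

definition orthonormal_basis_L2 ::
    "real set \<Rightarrow> 'i set \<Rightarrow> ('i \<Rightarrow> real \<Rightarrow> real) \<Rightarrow> bool" where
  "orthonormal_basis_L2 T I u \<longleftrightarrow>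
     orthonormal_family T I u \<and>
     (\<forall>f. l2_function T f \<longrightarrow>
        (\<forall>\<delta>>0. \<exists>F a. finite F \<and> F \<subseteq> I \<and>
           (LINT x:T|lborel. (f x - (\<Sum>i\<in>F. a i * u i x))\<^sup>2) < \<delta>))"


section \<open>Wavelet systems\<close>

text \<open>
  The coarsest level \<open>J\<^sub>0\<close>, the scaling functions \<open>\<phi>\<^sub>k\<close> and the wavelets \<open>\<psi>\<^sub>l\<^sub>k\<close>, with their index sets.
\<close>

record wavelet_system =
  coarse :: nat
  phi_index :: "int set"
  phi :: "int \<Rightarrow> real \<Rightarrow> real"
  psi_index :: "nat \<Rightarrow> int set"
  psi :: "nat \<Rightarrow> int \<Rightarrow> real \<Rightarrow> real"

definition wavelet_family :: "wavelet_system \<Rightarrow> int + nat \<times> int \<Rightarrow> real \<Rightarrow> real" where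
  "wavelet_family W = case_sum (phi W) (\<lambda>(l, k). psi W l k)"

definition wavelet_indices :: "wavelet_system \<Rightarrow> (int + nat \<times> int) set" where
  "wavelet_indices W = phi_index W <+> (SIGMA l:{coarse W..}. psi_index W l)"


section \<open>Daubechies wavelets on the line\<close>

definition continuously_differentiable_times :: "nat \<Rightarrow> (real \<Rightarrow> real) \<Rightarrow> bool" where
  "continuously_differentiable_times S f \<longleftrightarrow>
     (\<exists>D. D 0 = f \<and>
          (\<forall>i<S. \<forall>x. (D i has_real_derivative D (Suc i) x) (at x)) \<and>
          continuous_on UNIV (D S))"

text \<open>
  The Daubechies scaling function and wavelet of order \<open>p\<close>: orthonormal, with a filter
  \<open>h\<close> of length \<open>2 p\<close> (the shortest possible) and \<open>p\<close> vanishing moments. The translation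
  is normalised such that the supports lie in \<open>[1 - p, p]\<close>. No choice of the roots in the
  spectral factorisation is made, so that least asymmetric filters are covered as well.
  The bound \<open>S \<le> p\<close> is part of the usual notion of \<open>S\<close>-regularity; for compactly
  supported orthonormal wavelets it already follows from the smoothness.
\<close>

definition daubechies_pair ::
    "nat \<Rightarrow> nat \<Rightarrow> (real \<Rightarrow> real) \<Rightarrow> (real \<Rightarrow> real) \<Rightarrow> bool" where
  "daubechies_pair S p \<phi> \<psi> \<longleftrightarrow>
     S \<le> p \<and>
     continuously_differentiable_times S \<phi> \<and>
     continuously_differentiable_times S \<psi> \<and>
     (\<forall>x. x \<notin> {1 - real p..real p} \<longrightarrow> \<phi> x = 0 \<and> \<psi> x = 0) \<and>
     (LINT x|lborel. \<phi> x) = 1 \<and>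
     orthonormal_family UNIV UNIV (\<lambda>(k::int) x. \<phi> (x - of_int k)) \<and>
     (\<exists>h :: int \<Rightarrow> real.
        (\<forall>x. \<phi> x = sqrt 2 * (\<Sum>k=1 - int p..int p. h k * \<phi> (2 * x - of_int k))) \<and>
        (\<forall>x. \<psi> x = sqrt 2 *
           (\<Sum>k=1 - int p..int p. (-1) powi k * h (1 - k) * \<phi> (2 * x - of_int k)))) \<and>
     (\<forall>i<p. (LINT x|lborel. x ^ i * \<psi> x) = 0)"

definition daubechies_basis_line :: "nat \<Rightarrow> wavelet_system \<Rightarrow> bool" where
  "daubechies_basis_line S W \<longleftrightarrow>
     (\<exists>p \<phi> \<psi>. daubechies_pair S p \<phi> \<psi> \<and>
        coarse W = 0 \<and>
        phi_index W = UNIV \<and>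
        phi W = (\<lambda>k x. \<phi> (x - of_int k)) \<and>
        psi_index W = (\<lambda>l. UNIV) \<and>
        psi W = (\<lambda>l k x. 2 powr (real l / 2) * \<psi> (2 ^ l * x - of_int k))) \<and>
     orthonormal_basis_L2 UNIV (wavelet_indices W) (wavelet_family W)"


section \<open>Boundary-corrected Daubechies wavelets on the unit interval\<close>

text \<open>
  The construction of Cohen, Daubechies and Vial. At level \<open>j\<close> there are \<open>2 ^ j\<close> scaling
  functions (and as many wavelets): the dilated translates by \<open>m = p, ..., 2 ^ j - p - 1\<close> of the
  function \<open>M\<close> on the line, \<open>p\<close> functions \<open>L 1, ..., L p\<close> living on \<open>[0, \<infinity>)\<close> at the left end point
  and \<open>p\<close> functions \<open>R 1, ..., R p\<close> living on \<open>(-\<infinity>, 0]\<close>, moved to the right end point. The index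
  \<open>k = 1, ..., 2 ^ j\<close> corresponds to \<open>m = k - 1\<close>.
\<close>

definition interval_family ::
    "nat \<Rightarrow> (int \<Rightarrow> real \<Rightarrow> real) \<Rightarrow> (real \<Rightarrow> real) \<Rightarrow> (int \<Rightarrow> real \<Rightarrow> real) \<Rightarrow>
     nat \<Rightarrow> int \<Rightarrow> real \<Rightarrow> real" where
  "interval_family p L M R j k x =
     2 powr (real j / 2) *
       (if k \<le> int p then L k (2 ^ j * x)
        else if k \<le> 2 ^ j - int p then M (2 ^ j * x - of_int (k - 1))
        else R (2 ^ j + 1 - k) (2 ^ j * (x - 1)))"

text \<open>
  The functions \<open>e 1, ..., e p\<close> span, on the half-line \<open>H\<close>, the same space as the \<open>p\<close> edge functions
  \<open>x \<mapsto> (\<Sum>m\<in>A. m ^ i * \<phi> (x - m))\<close>, \<open>i < p\<close>. Here \<open>A\<close> consists of those translates that meet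
  the interior of \<open>H\<close> but are not among the interior scaling functions, so that the edge
  functions and the interior ones together reproduce all polynomials of degree less than \<open>p\<close>.
\<close>

definition spans_edge_space ::
    "nat \<Rightarrow> (real \<Rightarrow> real) \<Rightarrow> int set \<Rightarrow> real set \<Rightarrow> (int \<Rightarrow> real \<Rightarrow> real) \<Rightarrow> bool" where
  "spans_edge_space p \<phi> A H e \<longleftrightarrow>
     (\<forall>k\<in>{1..int p}. \<exists>a. \<forall>x\<in>H.
        e k x = (\<Sum>i<p. a i * (\<Sum>m\<in>A. of_int m ^ i * \<phi> (x - of_int m)))) \<and>
     (\<forall>i<p. \<exists>a. \<forall>x\<in>H.
        (\<Sum>m\<in>A. of_int m ^ i * \<phi> (x - of_int m)) = (\<Sum>k=1..int p. a k * e k x))"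

text \<open>
  For every level \<open>j \<ge> J\<^sub>0\<close>, the \<open>2 * 2 ^ j\<close> scaling functions and wavelets at level \<open>j\<close> form an
  orthonormal family inside the space spanned by the \<open>2 ^ (j + 1)\<close> scaling functions at level
  \<open>j + 1\<close>, i.e. the wavelets are an orthonormal basis of the orthogonal complement of \<open>V\<^sub>j\<close> in
  \<open>V\<^sub>j\<^sub>+\<^sub>1\<close>. In particular all functions inherit the smoothness of \<open>\<phi>\<close>.
\<close>

definition interval_multiresolution ::
    "nat \<Rightarrow> (nat \<Rightarrow> int \<Rightarrow> real \<Rightarrow> real) \<Rightarrow> (nat \<Rightarrow> int \<Rightarrow> real \<Rightarrow> real) \<Rightarrow> bool" where
  "interval_multiresolution J \<Phi> \<Psi> \<longleftrightarrow>
     (\<forall>j\<ge>J.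
        orthonormal_family {0..1} ({1..2 ^ j} <+> {1..2 ^ j}) (case_sum (\<Phi> j) (\<Psi> j)) \<and>
        (\<forall>u \<in> \<Phi> j ` {1..2 ^ j} \<union> \<Psi> j ` {1..2 ^ j}.
           \<exists>a. \<forall>x\<in>{0..1}. u x = (\<Sum>k=1..2 ^ Suc j. a k * \<Phi> (Suc j) k x)))"

definition daubechies_basis_interval :: "nat \<Rightarrow> wavelet_system \<Rightarrow> bool" where
  "daubechies_basis_interval S W \<longleftrightarrow>
     (\<exists>p \<phi> \<psi> \<phi>L \<phi>R \<psi>L \<psi>R.
        let \<Phi> = interval_family p \<phi>L \<phi> \<phi>R; \<Psi> = interval_family p \<psi>L \<psi> \<psi>R in
        daubechies_pair S p \<phi> \<psi> \<and>
        2 * p \<le> 2 ^ coarse W \<and>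
        spans_edge_space p \<phi> {1 - int p..int p - 1} {0..} \<phi>L \<and>
        spans_edge_space p \<phi> {- int p..int p - 2} {..0} \<phi>R \<and>
        (\<forall>k\<in>{1..int p}. \<forall>x>2 * real p - 1. \<psi>L k x = 0 \<and> \<psi>R k (- x) = 0) \<and>
        interval_multiresolution (coarse W) \<Phi> \<Psi> \<and>
        phi_index W = {1..2 ^ coarse W} \<and>
        phi W = \<Phi> (coarse W) \<and>
        psi_index W = (\<lambda>l. {1..2 ^ l}) \<and>
        psi W = \<Psi>) \<and>
     orthonormal_basis_L2 {0..1} (wavelet_indices W) (wavelet_family W)"

definition daubechies_wavelet_basis :: "real set \<Rightarrow> nat \<Rightarrow> wavelet_system \<Rightarrow> bool" where
  "daubechies_wavelet_basis T S W \<longleftrightarrow>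
     T = {0..1} \<and> daubechies_basis_interval S W \<or>
     T = UNIV \<and> daubechies_basis_line S W"


section \<open>Wavelet coefficients, Hoelder norm and partial sums\<close>

definition sup_norm :: "real set \<Rightarrow> (real \<Rightarrow> real) \<Rightarrow> ereal" where
  "sup_norm T f = (SUP x\<in>T. ereal \<bar>f x\<bar>)"

definition alpha :: "real set \<Rightarrow> wavelet_system \<Rightarrow> int \<Rightarrow> (real \<Rightarrow> real) \<Rightarrow> real" where
  "alpha T W k f = (LINT x:T|lborel. f x * phi W k x)"

definition beta :: "real set \<Rightarrow> wavelet_system \<Rightarrow> nat \<Rightarrow> int \<Rightarrow> (real \<Rightarrow> real) \<Rightarrow> real" where
  "beta T W l k f = (LINT x:T|lborel. f x * psi W l k x)"

definition holder_norm ::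
    "real set \<Rightarrow> wavelet_system \<Rightarrow> real \<Rightarrow> (real \<Rightarrow> real) \<Rightarrow> ereal" where
  "holder_norm T W s f =
     max (SUP k\<in>phi_index W. ereal \<bar>alpha T W k f\<bar>)
         (SUP (l, k)\<in>(SIGMA l:{coarse W..}. psi_index W l).
            ereal (2 powr (real l * (s + 1/2)) * \<bar>beta T W l k f\<bar>))"

text \<open>
  On the line only finitely many terms of the sums over \<open>k\<close> are nonzero at a given \<open>x\<close>.
\<close>

definition partial_sum ::
    "real set \<Rightarrow> wavelet_system \<Rightarrow> nat \<Rightarrow> (real \<Rightarrow> real) \<Rightarrow> real \<Rightarrow> real" where
  "partial_sum T W j f x =
     (\<Sum>\<^sub>\<infinity>k\<in>phi_index W. alpha T W k f * phi W k x) +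
     (\<Sum>l\<in>{coarse W..<j}. \<Sum>\<^sub>\<infinity>k\<in>psi_index W l. beta T W l k f * psi W l k x)"


section \<open>Classes of densities\<close>

definition Sigma_class ::
    "real set \<Rightarrow> wavelet_system \<Rightarrow> real \<Rightarrow> real \<Rightarrow> (real \<Rightarrow> real) set" where
  "Sigma_class T W B s =
     {f. (\<forall>x\<in>T. 0 \<le> f x) \<and> continuous_on T f \<and> bounded (f ` T) \<and>
         (LINT x:T|lborel. f x) = 1 \<and> holder_norm T W s f \<le> ereal B}"

definition Sigma_tilde ::
    "real set \<Rightarrow> wavelet_system \<Rightarrow> real \<Rightarrow> real \<Rightarrow> real \<Rightarrow> real \<Rightarrow> (real \<Rightarrow> real) set" where
  "Sigma_tilde T W B t s \<rho> =
     {f \<in> Sigma_class T W B s.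
        (INF g\<in>Sigma_class T W B t. sup_norm T (\<lambda>x. g x - f x)) \<ge> ereal \<rho>}"

definition Sigma_bar ::
    "real set \<Rightarrow> wavelet_system \<Rightarrow> real \<Rightarrow> real \<Rightarrow> real \<Rightarrow> nat \<Rightarrow> (real \<Rightarrow> real) set" where
  "Sigma_bar T W B \<epsilon> s m =
     {f \<in> Sigma_class T W B s.
        \<forall>l\<ge>m. ereal (\<epsilon> * 2 powr (- real l * s))
                  \<le> sup_norm T (\<lambda>x. partial_sum T W l f x - f x) \<and>
               sup_norm T (\<lambda>x. partial_sum T W l f x - f x)
                  \<le> ereal (B * 2 powr (- real l * s))}"

definition rate :: "real \<Rightarrow> nat \<Rightarrow> real" where
  "rate s n = (ln (real n) / real n) powr (s / (2 * s + 1))"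

definition dominates_rate :: "real \<Rightarrow> (nat \<Rightarrow> nat) \<Rightarrow> bool" where
  "dominates_rate s lev \<longleftrightarrow>
     filterlim (\<lambda>n. 2 powr (- real (lev n) * s) / rate s n) at_top sequentially"

end

theory Submission
  imports Defs "HOL-Real_Asymp.Real_Asymp"
begin

text \<open>
  Part (a). For \<open>f\<close> in a \<open>\<Sigma>\<close>-bar class and \<open>g \<in> \<Sigma>(t)\<close> with \<open>\<delta> = \<parallel>f - g\<parallel>\<close>, the weighted coefficient
  \<open>2\<^bsup>j/2\<^esup> \<bar>\<beta>\<^sub>j\<^sub>k(f)\<bar>\<close> is at most \<open>B 2\<^bsup>-jt\<^esup> + C \<delta>\<close>, because \<open>\<beta>\<^sub>j\<^sub>k(g)\<close> is small and
  \<open>\<parallel>\<psi>\<^sub>j\<^sub>k\<parallel>\<^sub>1\<close> is of order \<open>2\<^bsup>-j/2\<^esup>\<close>; it is also at most \<open>B 2\<^bsup>-js\<^esup>\<close>. Using the first bound for the \<open>q\<close>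
  levels \<open>l \<le> j < l + q\<close> and the second one from level \<open>l + q\<close> on gives
  \<open>\<parallel>K\<^sub>l(f) - f\<parallel> \<le> C' (q 2\<^bsup>-lt\<^esup> + q \<delta> + 2\<^bsup>-(l+q)s\<^esup>)\<close>. For a large constant \<open>q\<close> and \<open>l\<close> equal to \<open>\<ell>\<^sub>n\<close>
  plus a large constant, the lower bound \<open>\<epsilon> 2\<^bsup>-ls\<^esup>\<close> on the left-hand side forces \<open>\<delta>\<close> to be at least a
  multiple of \<open>2\<^bsup>-ls\<^esup>\<close>. Boundedness of \<open>K\<^sub>l\<close> in the supremum norm is never needed.

  Part (b). Since \<open>r\<^sub>n(s)\<close> tends to \<open>0\<close>, a single density serves all large \<open>n\<close>: add a multiple of one
  wavelet, at a fixed fine level, to a density in the span of the scaling functions. The added coefficient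
  is too large for \<open>\<Sigma>(t)\<close>, whereas \<open>K\<^sub>l(f) = f\<close> for all large \<open>l\<close>, so that \<open>f\<close> lies in no \<open>\<Sigma>\<close>-bar class. On
  \<open>[0, 1]\<close> the density to start from is the constant \<open>1\<close>, on the line it is a multiple of
  \<open>\<Sum>\<^sub>k exp (- a \<bar>k\<bar>) \<phi>\<^sub>k\<close> with small \<open>a\<close>; both rest on the partition of unity \<open>\<Sum>\<^sub>k \<phi>\<^sub>k = 1\<close>.
\<close>

section \<open>Best approximation\<close>

lemma set_integrable_mult_l2:
  assumes "l2_function T f" "l2_function T g" and T: "T \<in> sets borel"
  shows "set_integrable lborel T (\<lambda>x. f x * g x)"
proof -
  have [measurable]: "f \<in> borel_measurable borel" "g \<in> borel_measurable borel" "T \<in> sets borel"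
    using assms by (auto simp: l2_function_def)
  have i: "set_integrable lborel T (\<lambda>x. (f x)\<^sup>2 + (g x)\<^sup>2)"
    using assms by (intro set_integral_add) (auto simp: l2_function_def)
  have bound: "\<bar>a * b\<bar> \<le> a\<^sup>2 + b\<^sup>2" for a b :: real
  proof -
    have "2 * (\<bar>a\<bar> * \<bar>b\<bar>) \<le> a\<^sup>2 + b\<^sup>2"
      using sum_squares_bound[of "\<bar>a\<bar>" "\<bar>b\<bar>"] by simp
    moreover have "0 \<le> \<bar>a\<bar> * \<bar>b\<bar>" by simp
    ultimately show ?thesis unfolding abs_mult by linarith
  qed
  show ?thesis
    by (rule set_integrable_bound[OF i])
       (auto simp: set_borel_measurable_def intro: order_trans[OF bound])
qed

lemma power2_diff_sum:
  fixes a b :: "'i \<Rightarrow> real"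
  shows "(f - (\<Sum>i\<in>F. a i * b i))\<^sup>2 =
    f\<^sup>2 - (\<Sum>i\<in>F. 2 * a i * (f * b i)) + (\<Sum>i\<in>F. \<Sum>j\<in>F. (a i * a j) * (b i * b j))"
proof -
  have "(\<Sum>i\<in>F. a i * b i)\<^sup>2 = (\<Sum>i\<in>F. \<Sum>j\<in>F. (a i * a j) * (b i * b j))"
    by (simp add: power2_eq_square sum_product algebra_simps)
  moreover have "(\<Sum>i\<in>F. 2 * a i * (f * b i)) = 2 * f * (\<Sum>i\<in>F. a i * b i)"
    by (simp add: sum_distrib_left algebra_simps)
  ultimately show ?thesis
    by (simp add: power2_diff)
qed

lemma l2_distance_expand:
  assumes on: "orthonormal_family T I u" and f: "l2_function T f" and T: "T \<in> sets borel"
    and F: "finite F" "F \<subseteq> I"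
  shows "set_integrable lborel T (\<lambda>x. (f x - (\<Sum>i\<in>F. a i * u i x))\<^sup>2)" (is ?A)
    and "(LINT x:T|lborel. (f x - (\<Sum>i\<in>F. a i * u i x))\<^sup>2) =
      l2_inner T f f - (\<Sum>i\<in>F. 2 * a i * l2_inner T f (u i)) + (\<Sum>i\<in>F. (a i)\<^sup>2)" (is ?B)
proof -
  have u: "l2_function T (u i)" if "i \<in> F" for i
    using on F that by (auto simp: orthonormal_family_def)
  have ff: "integrable lborel (\<lambda>x. indicat_real T x *\<^sub>R (f x)\<^sup>2)"
    using f by (simp add: l2_function_def set_integrable_def)
  have fu: "integrable lborel (\<lambda>x. indicat_real T x *\<^sub>R (f x * u i x))" if "i \<in> F" for i
    using set_integrable_mult_l2[OF f u[OF that] T] by (simp add: set_integrable_def)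
  have uu: "integrable lborel (\<lambda>x. indicat_real T x *\<^sub>R (u i x * u j x))" if "i \<in> F" "j \<in> F" for i j
    using set_integrable_mult_l2[OF u u T] that by (simp add: set_integrable_def)
  have eq: "indicat_real T x *\<^sub>R (f x - (\<Sum>i\<in>F. a i * u i x))\<^sup>2 =
      indicat_real T x *\<^sub>R (f x)\<^sup>2 - (\<Sum>i\<in>F. (2 * a i) * (indicat_real T x *\<^sub>R (f x * u i x))) +
      (\<Sum>i\<in>F. \<Sum>j\<in>F. (a i * a j) * (indicat_real T x *\<^sub>R (u i x * u j x)))" for x
    unfolding power2_diff_sum by (auto simp: indicator_def)
  let ?N = "l2_inner T f f - (\<Sum>i\<in>F. (2 * a i) * l2_inner T f (u i)) +
     (\<Sum>i\<in>F. \<Sum>j\<in>F. (a i * a j) * l2_inner T (u i) (u j))"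
  have "has_bochner_integral lborel
      (\<lambda>x. indicat_real T x *\<^sub>R (f x - (\<Sum>i\<in>F. a i * u i x))\<^sup>2) ?N"
    unfolding eq l2_inner_def set_lebesgue_integral_def
    by (intro has_bochner_integral_add has_bochner_integral_diff has_bochner_integral_sum
        has_bochner_integral_mult_right has_bochner_integral_integrable fu uu)
       (use ff in \<open>simp add: has_bochner_integral_integrable power2_eq_square\<close>)
  moreover have "(\<Sum>i\<in>F. \<Sum>j\<in>F. (a i * a j) * l2_inner T (u i) (u j)) =
      (\<Sum>i\<in>F. \<Sum>j\<in>F. if i = j then (a i)\<^sup>2 else 0)"
    using on F by (intro sum.cong refl) (auto simp: orthonormal_family_def subset_iff power2_eq_square)
  ultimately show ?A ?B
    using F by (auto simp: set_integrable_def set_lebesgue_integral_def sum.delta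
        has_bochner_integral_iff)
qed

text \<open>Completeness supplies some finite combination that is close to \<open>f\<close>.
  Extending its index set to contain \<open>F\<close> costs nothing, since the new coefficients may
  be 0, and replacing all coefficients by the inner products can only decrease the error. The
  freedom to prescribe \<open>F\<close> is what later allows comparison with a partial sum of the
  wavelet series.\<close>

lemma l2_best_approximation:
  assumes basis: "orthonormal_basis_L2 T I u" and f: "l2_function T f" and T: "T \<in> sets borel"
    and F: "finite F" "F \<subseteq> I" and \<delta>: "0 < \<delta>"
  obtains G where "finite G" "F \<subseteq> G" "G \<subseteq> I"
    "set_integrable lborel T (\<lambda>x. (f x - (\<Sum>i\<in>G. l2_inner T f (u i) * u i x))\<^sup>2)"
    "(LINT x:T|lborel. (f x - (\<Sum>i\<in>G. l2_inner T f (u i) * u i x))\<^sup>2) < \<delta>"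
proof -
  have on: "orthonormal_family T I u"
    using basis by (simp add: orthonormal_basis_L2_def)
  obtain H a where H: "finite H" "H \<subseteq> I"
    "(LINT x:T|lborel. (f x - (\<Sum>i\<in>H. a i * u i x))\<^sup>2) < \<delta>"
    using basis[unfolded orthonormal_basis_L2_def, THEN conjunct2, rule_format, OF f \<delta>] by blast
  define G where "G = F \<union> H"
  have G: "finite G" "G \<subseteq> I" "H \<subseteq> G"
    using F H by (auto simp: G_def)
  define b where "b i = (if i \<in> H then a i else 0)" for i
  have restrict: "(\<Sum>i\<in>G. b i * u i x) = (\<Sum>i\<in>H. a i * u i x)" for x
    using G by (intro sum.mono_neutral_cong_right) (auto simp: b_def)
  let ?c = "\<lambda>i. l2_inner T f (u i)"
  note ex = l2_distance_expand(2)[OF on f T G(1,2)]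
  \<comment> \<open>Completing the square: the error with coefficients \<open>b\<close> exceeds the
    error with the inner products by exactly this sum.\<close>
  have "0 \<le> (\<Sum>i\<in>G. (b i - ?c i)\<^sup>2)"
    by (intro sum_nonneg) auto
  also have "\<dots> = (\<Sum>i\<in>G. (b i)\<^sup>2) - (\<Sum>i\<in>G. 2 * b i * ?c i) + (\<Sum>i\<in>G. (?c i)\<^sup>2)"
    by (simp add: power2_diff sum.distrib sum_subtractf algebra_simps)
  moreover have "(\<Sum>i\<in>G. 2 * ?c i * ?c i) = 2 * (\<Sum>i\<in>G. (?c i)\<^sup>2)"
    by (simp add: power2_eq_square sum_distrib_left algebra_simps)
  ultimately have "(LINT x:T|lborel. (f x - (\<Sum>i\<in>G. ?c i * u i x))\<^sup>2) \<le>
      (LINT x:T|lborel. (f x - (\<Sum>i\<in>G. b i * u i x))\<^sup>2)"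
    unfolding ex by linarith
  also have "\<dots> = (LINT x:T|lborel. (f x - (\<Sum>i\<in>H. a i * u i x))\<^sup>2)"
    by (simp add: restrict)
  finally show thesis
    using H(3) G l2_distance_expand(1)[OF on f T G(1,2), of ?c]
    by (intro that[of G]) (auto simp: G_def)
qed

section \<open>Wavelet systems with localised wavelets\<close>

text \<open>Square integrability follows from f^2 \<le> M |f|. The indicator is there because a
  density is only controlled on \<open>T\<close>, whereas \<open>l2_function\<close> asks for
  measurability on the whole line.\<close>

lemma l2_function_indicator:
  assumes "continuous_on T f" "bounded (f ` T)" "set_integrable lborel T f" and T: "closed T"
  shows "l2_function T (\<lambda>x. indicat_real T x * f x)"
proof -
  have T': "T \<in> sets borel" using T by auto
  obtain M where M: "\<And>x. x \<in> T \<Longrightarrow> \<bar>f x\<bar> \<le> M"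
    using assms(2) by (auto simp: bounded_iff)
  have m: "(\<lambda>x. indicat_real T x * f x) \<in> borel_measurable borel"
    using borel_measurable_continuous_on_indicator[OF T' assms(1)] by simp
  have i: "integrable lborel (\<lambda>x. M * (indicat_real T x * f x))"
    using assms(3) by (intro integrable_mult_right) (simp add: set_integrable_def)
  have "integrable lborel (\<lambda>x. (indicat_real T x * f x)\<^sup>2)"
  proof (rule Bochner_Integration.integrable_bound[OF i])
    show "(\<lambda>x. (indicat_real T x * f x)\<^sup>2) \<in> borel_measurable lborel"
      using m by simp
    have "\<bar>indicat_real T x * f x\<bar> * \<bar>indicat_real T x * f x\<bar> \<le> \<bar>M\<bar> * \<bar>indicat_real T x * f x\<bar>" for x
      using M[of x] by (intro mult_right_mono) (auto simp: indicator_def)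
    then show "AE x in lborel. norm ((indicat_real T x * f x)\<^sup>2) \<le> norm (M * (indicat_real T x * f x))"
      by (simp add: power2_eq_square abs_mult)
  qed
  moreover have "(\<lambda>x. indicat_real T x *\<^sub>R (indicat_real T x * f x)\<^sup>2) = (\<lambda>x. (indicat_real T x * f x)\<^sup>2)"
    by (auto simp: indicator_def fun_eq_iff)
  ultimately show ?thesis
    using m unfolding l2_function_def set_integrable_def by simp
qed

lemma l2_inner_indicator: "l2_inner T (\<lambda>x. indicat_real T x * f x) u = (LINT x:T|lborel. f x * u x)"
  unfolding l2_inner_def set_lebesgue_integral_def
  by (intro Bochner_Integration.integral_cong) (auto simp: indicator_def)

lemma ereal_sup_norm_le:
  "sup_norm T f \<le> ereal M \<longleftrightarrow> (\<forall>x\<in>T. \<bar>f x\<bar> \<le> M)"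
  by (simp add: sup_norm_def SUP_le_iff)

text \<open>The integral of a non-integrable function has the default value 0, so the normalisation
  to 1 already forces integrability.\<close>

lemma Sigma_class_integrable:
  assumes "f \<in> Sigma_class T W B s"
  shows "set_integrable lborel T f"
proof (rule ccontr)
  assume "\<not> set_integrable lborel T f"
  then have "(LINT x:T|lborel. f x) = 0"
    unfolding set_integrable_def set_lebesgue_integral_def by (rule not_integrable_integral_eq)
  then show False
    using assms by (simp add: Sigma_class_def)
qed

text \<open>The weight 2^(l/2) is the order of the supremum of a wavelet at level \<open>l\<close>,
  so the left-hand side measures what a single coefficient contributes to the series at a
  point.\<close>

lemma Sigma_class_beta:
  assumes "f \<in> Sigma_class T W B s" "coarse W \<le> l" "k \<in> psi_index W l"
  shows "2 powr (real l / 2) * \<bar>beta T W l k f\<bar> \<le> B * 2 powr (- real l * s)"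
proof -
  have "ereal (2 powr (real l * (s + 1/2)) * \<bar>beta T W l k f\<bar>) \<le> holder_norm T W s f"
    unfolding holder_norm_def using assms(2,3)
    by (intro max.coboundedI2 SUP_upper2[of "(l, k)"]) auto
  also have "\<dots> \<le> ereal B"
    using assms(1) by (simp add: Sigma_class_def)
  finally have "(2 powr (real l * (s + 1/2)) * 2 powr (- real l * s)) * \<bar>beta T W l k f\<bar> \<le> B * 2 powr (- real l * s)"
    using mult_right_mono[of "2 powr (real l * (s + 1/2)) * \<bar>beta T W l k f\<bar>" B "2 powr (- real l * s)"]
    by (simp add: ac_simps)
  moreover have "2 powr (real l * (s + 1/2)) * 2 powr (- real l * s) = (2::real) powr (real l / 2)"
    by (simp add: powr_add[symmetric] algebra_simps)
  ultimately show ?thesis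
    by (simp only:)
qed

text \<open>The common ground of the line and the interval: \<open>C\<close> bounds the amplitude of
  a wavelet, \<open>D\<close> the length of its support after dilation, and \<open>N\<close> the
  number of wavelets of one level that overlap at a point. Every condition is restricted to
  \<open>T\<close>, so that boundary-corrected functions fit in. The finiteness conditions make the
  sums over \<open>k\<close> locally finite, and they give \<open>psi_card\<close> its force,
  because an infinite set would have \<open>card\<close> 0.\<close>

locale localised_wavelets =
  fixes T :: "real set" and W :: wavelet_system and C D :: real and N :: nat
  assumes basis: "orthonormal_basis_L2 T (wavelet_indices W) (wavelet_family W)"
    and T_cases: "T = {0..1} \<or> T = UNIV"
    and constants: "0 < C" "0 < D" "0 < N"
    and phi_cont: "\<And>k. k \<in> phi_index W \<Longrightarrow> continuous_on T (phi W k)"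
    and psi_cont: "\<And>l k. coarse W \<le> l \<Longrightarrow> k \<in> psi_index W l \<Longrightarrow> continuous_on T (psi W l k)"
    and phi_finite: "\<And>r. finite {k \<in> phi_index W. \<exists>x\<in>T. \<bar>x\<bar> \<le> r \<and> phi W k x \<noteq> 0}"
    and psi_finite: "\<And>l r. coarse W \<le> l \<Longrightarrow>
      finite {k \<in> psi_index W l. \<exists>x\<in>T. \<bar>x\<bar> \<le> r \<and> psi W l k x \<noteq> 0}"
    and psi_bound: "\<And>l k x. coarse W \<le> l \<Longrightarrow> k \<in> psi_index W l \<Longrightarrow> x \<in> T \<Longrightarrow>
      \<bar>psi W l k x\<bar> \<le> C * 2 powr (real l / 2)"
    and psi_card: "\<And>l x. coarse W \<le> l \<Longrightarrow> x \<in> T \<Longrightarrow>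
      card {k \<in> psi_index W l. psi W l k x \<noteq> 0} \<le> N"
    and psi_support: "\<And>l k. coarse W \<le> l \<Longrightarrow> k \<in> psi_index W l \<Longrightarrow>
      \<exists>a. \<forall>x\<in>T. psi W l k x \<noteq> 0 \<longrightarrow> x \<in> {a..a + D / 2 ^ l}"
begin

lemma T_closed: "closed T" and T_borel: "T \<in> sets borel"
  using T_cases by auto

text \<open>Pointwise bounds are derived below from integrals, which requires a set of positive
  measure inside \<open>T\<close> near \<open>x\<close>. Only at the right end point of the unit
  interval does the set have to lie to the left of \<open>x\<close>.\<close>

lemma interval_near:
  assumes "x \<in> T" "0 < d"
  obtains a b where "a < b" "{a..b} \<subseteq> T" "\<And>y. y \<in> {a..b} \<Longrightarrow> \<bar>y - x\<bar> < d"
proof (cases "T = {0..1} \<and> x = 1")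
  case True
  then show thesis
    using assms by (intro that[of "1 - min (d / 2) 1" 1]) auto
next
  case False
  show thesis
  proof (cases "T = UNIV")
    case True
    then show thesis
      using assms by (intro that[of x "x + d / 2"]) auto
  next
    case F2: False
    then show thesis
      using False assms T_cases by (intro that[of x "x + min (d / 2) (1 - x)"]) auto
  qed
qed

lemma orthonormal: "orthonormal_family T (wavelet_indices W) (wavelet_family W)"
  using basis by (simp add: orthonormal_basis_L2_def)

lemma psi_l2: "coarse W \<le> l \<Longrightarrow> k \<in> psi_index W l \<Longrightarrow> l2_function T (psi W l k)"
  using orthonormal
  by (force simp: orthonormal_family_def wavelet_indices_def wavelet_family_def
      dest: bspec[of _ _ "Inr (l, k)"])

lemma phi_l2: "k \<in> phi_index W \<Longrightarrow> l2_function T (phi W k)"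
  using orthonormal
  by (force simp: orthonormal_family_def wavelet_indices_def wavelet_family_def
      dest: bspec[of _ _ "Inl k"])

text \<open>Amplitude times length of support: C 2^(l/2) times D 2^(-l).\<close>

lemma psi_L1:
  assumes "coarse W \<le> l" "k \<in> psi_index W l"
  shows "set_integrable lborel T (psi W l k)"
    and "(LINT x:T|lborel. \<bar>psi W l k x\<bar>) \<le> C * D * 2 powr (- real l / 2)"
proof -
  obtain a where a: "\<And>x. x \<in> T \<Longrightarrow> psi W l k x \<noteq> 0 \<Longrightarrow> x \<in> {a..a + D / 2 ^ l}"
    using psi_support[OF assms] by blast
  let ?M = "C * 2 powr (real l / 2)"
  have bnd: "\<bar>indicat_real T x * psi W l k x\<bar> \<le> ?M * indicat_real {a..a + D / 2 ^ l} x" for x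
    using psi_bound[OF assms, of x] a[of x] constants by (auto simp: indicator_def)
  have m: "(\<lambda>x. indicat_real T x * psi W l k x) \<in> borel_measurable borel"
    using borel_measurable_continuous_on_indicator[OF T_borel psi_cont[OF assms]] by simp
  have i: "integrable lborel (\<lambda>x. ?M * indicat_real {a..a + D / 2 ^ l} x)"
    by (intro integrable_mult_right integrable_real_indicator) (auto simp: emeasure_lborel_Icc_eq)
  show 1: "set_integrable lborel T (psi W l k)"
    unfolding set_integrable_def
    by (rule Bochner_Integration.integrable_bound[OF i]) (use m bnd in \<open>auto simp: order_trans[OF bnd]\<close>)
  have "(LINT x:T|lborel. \<bar>psi W l k x\<bar>) \<le> (\<integral>x. ?M * indicat_real {a..a + D / 2 ^ l} x \<partial>lborel)"
    unfolding set_lebesgue_integral_def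
    using set_integrable_abs[OF 1] bnd
    by (intro integral_mono i) (auto simp: set_integrable_def abs_mult)
  also have "\<dots> = ?M * (D / 2 ^ l)"
    using constants by simp
  also have "\<dots> = C * D * (2 powr (real l / 2) * 2 powr (- real l))"
    by (simp add: powr_minus powr_realpow divide_simps)
  also have "2 powr (real l / 2) * 2 powr (- real l) = (2::real) powr (- real l / 2)"
    by (simp add: powr_add[symmetric])
  finally show "(LINT x:T|lborel. \<bar>psi W l k x\<bar>) \<le> C * D * 2 powr (- real l / 2)" .
qed

lemma set_integrable_times_l2:
  assumes "continuous_on T f" "bounded (f ` T)" "set_integrable lborel T f" "l2_function T u"
  shows "set_integrable lborel T (\<lambda>x. f x * u x)"
proof -
  have "set_integrable lborel T (\<lambda>x. (indicat_real T x * f x) * u x)"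
    using l2_function_indicator[OF assms(1-3) T_closed] assms(4) T_borel
    by (rule set_integrable_mult_l2)
  then show ?thesis
    by (rule set_integrable_cong[THEN iffD1, rotated -1]) auto
qed

text \<open>The supremum bound on f - g is paired with the L^1 norm of the wavelet. The weight
  2^(l/2) cancels the decay of that norm, so the constant C D is the same at every level.\<close>

lemma beta_diff_le:
  assumes f: "f \<in> Sigma_class T W B s" and g: "g \<in> Sigma_class T W B' s'"
    and lk: "coarse W \<le> l" "k \<in> psi_index W l"
    and d: "\<And>x. x \<in> T \<Longrightarrow> \<bar>f x - g x\<bar> \<le> d"
  shows "2 powr (real l / 2) * \<bar>beta T W l k f - beta T W l k g\<bar> \<le> C * D * d"
proof -
  have i: "set_integrable lborel T (\<lambda>x. h x * psi W l k x)"
    if "h \<in> Sigma_class T W B s" for h B s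
    using that lk
    by (intro set_integrable_times_l2 Sigma_class_integrable[OF that] psi_l2) (auto simp: Sigma_class_def)
  have "T \<noteq> {}" using T_cases by auto
  then have d0: "0 \<le> d" using d by (meson abs_ge_zero ex_in_conv order_trans)
  have i': "set_integrable lborel T (\<lambda>x. (f x - g x) * psi W l k x)"
    using set_integral_diff(1)[OF i[OF f] i[OF g]] by (simp add: left_diff_distrib)
  have "\<bar>beta T W l k f - beta T W l k g\<bar> = \<bar>LINT x:T|lborel. (f x - g x) * psi W l k x\<bar>"
    using set_integral_diff(2)[OF i[OF f] i[OF g]] by (simp add: beta_def left_diff_distrib)
  also have "\<dots> \<le> (LINT x:T|lborel. \<bar>(f x - g x) * psi W l k x\<bar>)"
    unfolding set_lebesgue_integral_def
    by (rule order_trans[OF integral_abs_bound]) (simp add: abs_mult)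
  also have "\<dots> \<le> (LINT x:T|lborel. d * \<bar>psi W l k x\<bar>)"
    using d d0 by (intro set_integral_mono set_integrable_abs i' psi_L1(1)[OF lk] set_integrable_mult_right)
      (auto simp: abs_mult intro: mult_right_mono)
  also have "\<dots> \<le> d * (C * D * 2 powr (- real l / 2))"
    using psi_L1(2)[OF lk] d0 by (simp add: mult_left_mono)
  finally have "2 powr (real l / 2) * \<bar>beta T W l k f - beta T W l k g\<bar> \<le>
     2 powr (real l / 2) * (d * (C * D * 2 powr (- real l / 2)))"
    by (intro mult_left_mono) auto
  also have "\<dots> = C * D * d * (2 powr (real l / 2) * 2 powr (- real l / 2))"
    by (simp only: ac_simps)
  also have "2 powr (real l / 2) * 2 powr (- real l / 2) = (1::real)"
    by (simp add: powr_add[symmetric])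
  finally show ?thesis by simp
qed

end

section \<open>Uniform error of the partial sums of the wavelet series\<close>

lemma infsum_eq_sum:
  assumes "finite A" "A \<subseteq> B" "\<And>k. k \<in> B - A \<Longrightarrow> f k = 0"
  shows "infsum f B = sum f A"
proof -
  have "infsum f B = infsum f A"
    using assms by (intro infsum_cong_neutral) auto
  then show ?thesis
    using assms(1) by simp
qed

context localised_wavelets
begin

text \<open>One finite index set that serves all points of \<open>T\<close> with |x| \<le> r at
  once: there K_l f is a fixed finite combination of continuous functions, hence continuous, also on
  the line where the sums over \<open>k\<close> are infinite.\<close>

definition local_indices :: "nat \<Rightarrow> real \<Rightarrow> (int + nat \<times> int) set" where
  "local_indices l r =
     {k \<in> phi_index W. \<exists>x\<in>T. \<bar>x\<bar> \<le> r \<and> phi W k x \<noteq> 0} <+>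
     (SIGMA j:{coarse W..<l}. {k \<in> psi_index W j. \<exists>x\<in>T. \<bar>x\<bar> \<le> r \<and> psi W j k x \<noteq> 0})"

lemma local_indices: "finite (local_indices l r)" "local_indices l r \<subseteq> wavelet_indices W"
proof -
  show "finite (local_indices l r)"
    unfolding local_indices_def
    using phi_finite psi_finite by (intro finite_Plus finite_SigmaI) auto
  show "local_indices l r \<subseteq> wavelet_indices W"
    unfolding local_indices_def wavelet_indices_def by auto
qed

lemma partial_sum_eq:
  assumes "x \<in> T" "\<bar>x\<bar> \<le> r"
  shows "partial_sum T W l f x =
    (\<Sum>i\<in>local_indices l r. (LINT y:T|lborel. f y * wavelet_family W i y) * wavelet_family W i x)"
proof -
  let ?A = "{k \<in> phi_index W. \<exists>x\<in>T. \<bar>x\<bar> \<le> r \<and> phi W k x \<noteq> 0}"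
  let ?P = "\<lambda>j. {k \<in> psi_index W j. \<exists>x\<in>T. \<bar>x\<bar> \<le> r \<and> psi W j k x \<noteq> 0}"
  have "(\<Sum>\<^sub>\<infinity>k\<in>phi_index W. alpha T W k f * phi W k x) = (\<Sum>k\<in>?A. alpha T W k f * phi W k x)"
    using phi_finite[of r] assms
    by (intro infsum_eq_sum) auto
  moreover have "(\<Sum>\<^sub>\<infinity>k\<in>psi_index W j. beta T W j k f * psi W j k x) =
      (\<Sum>k\<in>?P j. beta T W j k f * psi W j k x)" if "j \<in> {coarse W..<l}" for j
    using psi_finite[of j r] assms that
    by (intro infsum_eq_sum) auto
  ultimately have "partial_sum T W l f x = (\<Sum>k\<in>?A. alpha T W k f * phi W k x) +
      (\<Sum>j\<in>{coarse W..<l}. \<Sum>k\<in>?P j. beta T W j k f * psi W j k x)"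
    by (simp add: partial_sum_def)
  also have "(\<Sum>j\<in>{coarse W..<l}. \<Sum>k\<in>?P j. beta T W j k f * psi W j k x) =
     (\<Sum>(j, k)\<in>(SIGMA j:{coarse W..<l}. ?P j). beta T W j k f * psi W j k x)"
    using psi_finite by (intro sum.Sigma) auto
  finally show ?thesis
    unfolding local_indices_def
    using phi_finite psi_finite
    by (subst sum.Plus)
       (auto simp: wavelet_family_def alpha_def beta_def case_prod_beta intro!: finite_SigmaI)
qed

lemma family_cont: "i \<in> wavelet_indices W \<Longrightarrow> continuous_on T (wavelet_family W i)"
  using phi_cont psi_cont by (auto simp: wavelet_indices_def wavelet_family_def)

text \<open>
  The finite partial sums provided by completeness converge in \<open>L\<^sup>2(T)\<close> only. Those that contain
  all indices below level \<open>l\<close> differ from \<open>K\<^sub>l f\<close>, locally and uniformly, by at most the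
  tail of the wavelet series, and continuity turns this into a bound at every point.
\<close>

lemma partial_sum_error:
  assumes f: "continuous_on T f" "bounded (f ` T)" "set_integrable lborel T f"
    and l: "coarse W \<le> l"
    and e: "\<And>j k. l \<le> j \<Longrightarrow> k \<in> psi_index W j \<Longrightarrow> 2 powr (real j / 2) * \<bar>beta T W j k f\<bar> \<le> e j"
    and e_nonneg: "\<And>j. l \<le> j \<Longrightarrow> 0 \<le> e j"
    and E: "\<And>A. finite A \<Longrightarrow> A \<subseteq> {l..} \<Longrightarrow> sum e A \<le> E"
    and x: "x \<in> T"
  shows "\<bar>partial_sum T W l f x - f x\<bar> \<le> real N * C * E"
proof (rule ccontr)
  let ?I = "wavelet_indices W" and ?u = "wavelet_family W" and ?K = "partial_sum T W l f"
  define c where "c i = (LINT y:T|lborel. f y * ?u i y)" for i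
  \<comment> \<open>The additional 1 leaves room for an interval around \<open>x\<close>, chosen
    later with all points at distance less than 1 from \<open>x\<close>.\<close>
  define r where "r = \<bar>x\<bar> + 1"
  let ?F = "local_indices l r"
  \<comment> \<open>The excess of the error over the claimed bound. It is positive at
    \<open>x\<close> by assumption and, by continuity, at least half as large on a whole interval,
    which will contradict convergence in L^2.\<close>
  define q where "q y = \<bar>?K y - f y\<bar> - real N * C * E" for y
  assume "\<not> \<bar>?K x - f x\<bar> \<le> real N * C * E"
  then have q0: "0 < q x" by (simp add: q_def)
  \<comment> \<open>At a point with |y| \<le> r, an index of G outside \<open>?F\<close> whose
    function is nonzero at y can only be a wavelet of level at least \<open>l\<close>. Each level
    has at most \<open>N\<close> of these, each contributing at most C times
    \<open>e j\<close>.\<close>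
  have tail: "\<bar>(\<Sum>i\<in>G. c i * ?u i y) - ?K y\<bar> \<le> real N * C * E"
    if G: "finite G" "?F \<subseteq> G" "G \<subseteq> ?I" and y: "y \<in> T" "\<bar>y\<bar> \<le> r" for G y
  proof -
    define L where "L = {j. l \<le> j \<and> (\<exists>k. Inr (j, k) \<in> G)}"
    let ?P = "\<lambda>j. {k \<in> psi_index W j. psi W j k y \<noteq> 0}"
    have "L \<subseteq> fst ` projr ` G"
      by (force simp: L_def)
    then have L: "finite L" "L \<subseteq> {l..}"
      using G(1) by (meson finite_imageI finite_subset) (auto simp: L_def)
    have Pfin: "finite (?P j)" if "j \<in> L" for j
      using that L l y by (intro finite_subset[OF _ psi_finite[of j r]]) auto
    have "\<bar>(\<Sum>i\<in>G. c i * ?u i y) - ?K y\<bar> = \<bar>\<Sum>i\<in>G - ?F. c i * ?u i y\<bar>"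
      using partial_sum_eq[OF y, of l f] G(1,2) by (simp add: sum_diff c_def)
    also have "\<dots> \<le> (\<Sum>i\<in>G - ?F. \<bar>c i * ?u i y\<bar>)"
      by (rule sum_abs)
    also have "\<dots> = (\<Sum>i\<in>{i \<in> G - ?F. ?u i y \<noteq> 0}. \<bar>c i * ?u i y\<bar>)"
      using G(1) by (intro sum.mono_neutral_right) auto
    also have "\<dots> \<le> (\<Sum>i\<in>Inr ` (SIGMA j:L. ?P j). \<bar>c i * ?u i y\<bar>)"
    proof (rule sum_mono2)
      show "finite (Inr ` (SIGMA j:L. ?P j))"
        using L Pfin by (intro finite_imageI finite_SigmaI) auto
      show "{i \<in> G - ?F. ?u i y \<noteq> 0} \<subseteq> Inr ` (SIGMA j:L. ?P j)"
        using G(3) y unfolding wavelet_indices_def local_indices_def wavelet_family_def L_def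
        by (force split: sum.splits)
    qed auto
    also have "\<dots> = (\<Sum>(j, k)\<in>(SIGMA j:L. ?P j). \<bar>beta T W j k f\<bar> * \<bar>psi W j k y\<bar>)"
      by (subst sum.reindex)
         (auto simp: c_def beta_def wavelet_family_def abs_mult case_prod_beta intro!: sum.cong)
    also have "\<dots> = (\<Sum>j\<in>L. \<Sum>k\<in>?P j. \<bar>beta T W j k f\<bar> * \<bar>psi W j k y\<bar>)"
      using L Pfin by (intro sum.Sigma[symmetric]) auto
    also have "\<dots> \<le> (\<Sum>j\<in>L. real N * (C * e j))"
    proof (rule sum_mono)
      fix j assume j: "j \<in> L"
      then have lj: "l \<le> j" "coarse W \<le> j" using L l by auto
      have "\<bar>beta T W j k f\<bar> * \<bar>psi W j k y\<bar> \<le> C * e j" if k: "k \<in> ?P j" for k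
      proof -
        have "\<bar>beta T W j k f\<bar> * \<bar>psi W j k y\<bar> \<le> \<bar>beta T W j k f\<bar> * (C * 2 powr (real j / 2))"
          using psi_bound[OF lj(2), of k y] k y by (intro mult_left_mono) auto
        also have "\<dots> = C * (2 powr (real j / 2) * \<bar>beta T W j k f\<bar>)"
          by simp
        also have "\<dots> \<le> C * e j"
          using e[OF lj(1)] k constants by (intro mult_left_mono) auto
        finally show ?thesis .
      qed
      then have "(\<Sum>k\<in>?P j. \<bar>beta T W j k f\<bar> * \<bar>psi W j k y\<bar>) \<le> real (card (?P j)) * (C * e j)"
        by (rule sum_bounded_above)
      also have "\<dots> \<le> real N * (C * e j)"
        using psi_card[OF lj(2) y(1)] e_nonneg[OF lj(1)] constants by (intro mult_right_mono) auto
      finally show "(\<Sum>k\<in>?P j. \<bar>beta T W j k f\<bar> * \<bar>psi W j k y\<bar>) \<le> real N * (C * e j)" .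
    qed
    also have "\<dots> = real N * C * sum e L"
      by (simp add: sum_distrib_left mult.assoc)
    also have "\<dots> \<le> real N * C * E"
      using E[OF L] constants by (intro mult_left_mono) auto
    finally show ?thesis .
  qed
  let ?S = "T \<inter> {- r..r}"
  have K_cont: "continuous_on ?S ?K"
  proof (rule continuous_on_eq)
    show "continuous_on ?S (\<lambda>y. \<Sum>i\<in>?F. c i * ?u i y)"
      using local_indices(2)
      by (intro continuous_intros continuous_on_subset[OF family_cont]) auto
  qed (auto simp: partial_sum_eq[where r = r] c_def)
  have "continuous_on ?S q"
    unfolding q_def by (intro continuous_intros K_cont continuous_on_subset[OF f(1)]) auto
  moreover have "x \<in> ?S"
    using x by (auto simp: r_def)
  ultimately obtain d where d: "0 < d" "\<And>y. y \<in> ?S \<Longrightarrow> \<bar>y - x\<bar> < d \<Longrightarrow> \<bar>q y - q x\<bar> < q x / 2"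
    using q0 unfolding continuous_on_iff dist_real_def by (meson half_gt_zero)
  obtain a b where ab: "a < b" "{a..b} \<subseteq> T" "\<And>y. y \<in> {a..b} \<Longrightarrow> \<bar>y - x\<bar> < min d 1"
    using interval_near[OF x, of "min d 1"] d(1) by auto
  define \<eta> where "\<eta> = q x / 2"
  have \<eta>: "0 < \<eta>" using q0 by (simp add: \<eta>_def)
  have in_S: "y \<in> ?S" if "y \<in> {a..b}" for y
    using ab(2) ab(3)[OF that] that by (auto simp: r_def)
  have q_ge: "\<eta> \<le> q y" if "y \<in> {a..b}" for y
  proof -
    have "\<bar>q y - q x\<bar> < q x / 2"
      using d(2)[OF in_S[OF that]] ab(3)[OF that] by simp
    then show ?thesis unfolding \<eta>_def by linarith
  qed
  let ?f = "\<lambda>y. indicat_real T y * f y"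
  \<comment> \<open>On [a, b] the finite sum over G will miss \<open>f\<close> by at least
    \<open>\<eta>\<close>, so its squared L^2 error is at least \<eta>^2 (b - a). Asking for an
    error below this value yields the contradiction.\<close>
  have pos: "0 < \<eta>\<^sup>2 * (b - a)"
    using \<eta> ab(1) by simp
  obtain G where G: "finite G" "?F \<subseteq> G" "G \<subseteq> ?I"
    "set_integrable lborel T (\<lambda>y. (?f y - (\<Sum>i\<in>G. l2_inner T ?f (?u i) * ?u i y))\<^sup>2)"
    "(LINT y:T|lborel. (?f y - (\<Sum>i\<in>G. l2_inner T ?f (?u i) * ?u i y))\<^sup>2) < \<eta>\<^sup>2 * (b - a)"
    by (rule l2_best_approximation[OF basis l2_function_indicator[OF f T_closed] T_borel
        local_indices pos])
  have far: "\<eta>\<^sup>2 \<le> (?f y - (\<Sum>i\<in>G. l2_inner T ?f (?u i) * ?u i y))\<^sup>2" if y: "y \<in> {a..b}" for y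
  proof -
    have "y \<in> T" "\<bar>y\<bar> \<le> r" using in_S[OF y] by auto
    then have "\<eta> \<le> \<bar>f y - (\<Sum>i\<in>G. c i * ?u i y)\<bar>"
      using q_ge[OF y] tail[OF G(1-3), of y] unfolding q_def by linarith
    then have "\<eta>\<^sup>2 \<le> \<bar>f y - (\<Sum>i\<in>G. c i * ?u i y)\<bar>\<^sup>2"
      using \<eta> by (intro power_mono) auto
    then show ?thesis
      using \<open>y \<in> T\<close> by (simp add: l2_inner_indicator c_def)
  qed
  have "\<eta>\<^sup>2 * (b - a) = (\<integral>y. \<eta>\<^sup>2 * indicat_real {a..b} y \<partial>lborel)"
    using ab(1) by simp
  also have "\<dots> \<le> (LINT y:T|lborel. (?f y - (\<Sum>i\<in>G. l2_inner T ?f (?u i) * ?u i y))\<^sup>2)"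
    unfolding set_lebesgue_integral_def
  proof (rule integral_mono)
    show "integrable lborel (\<lambda>y. \<eta>\<^sup>2 * indicat_real {a..b} y)"
      by (intro integrable_mult_right integrable_real_indicator) (auto simp: emeasure_lborel_Icc_eq)
    show "\<eta>\<^sup>2 * indicat_real {a..b} y \<le> indicat_real T y *\<^sub>R
        (?f y - (\<Sum>i\<in>G. l2_inner T ?f (?u i) * ?u i y))\<^sup>2" for y
    proof (cases "y \<in> {a..b}")
      case True
      then have "y \<in> T" using ab(2) by auto
      with far[OF True] True show ?thesis by simp
    qed simp
  qed (use G(4) in \<open>simp add: set_integrable_def\<close>)
  finally show False using G(5) by simp
qed

end

section \<open>Separation from smoother densities\<close>

lemma two_powr_small:
  fixes s \<eta> K :: real
  assumes "0 < s" "0 < \<eta>"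
  obtains q :: nat where "n \<le> q" "K * 2 powr (- real q * s) \<le> \<eta>"
proof -
  have "(\<lambda>q. K * (2 powr (- s)) ^ q) \<longlonglongrightarrow> 0"
    using assms by (intro tendsto_mult_right_zero LIMSEQ_realpow_zero) (auto simp: powr_less_one)
  then have "\<forall>\<^sub>F q in sequentially. K * (2 powr (- s)) ^ q < \<eta>"
    using assms(2) by (rule order_tendstoD)
  then have "\<forall>\<^sub>F q in sequentially. n \<le> q \<and> K * (2 powr (- s)) ^ q < \<eta>"
    using eventually_ge_at_top by eventually_elim auto
  then obtain q where "n \<le> q" "K * (2 powr (- s)) ^ q < \<eta>"
    by (auto dest: eventually_happens)
  moreover have "(2 powr (- s)) ^ q = 2 powr (- real q * s)"
    by (simp add: powr_power mult.commute)
  ultimately show thesis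
    by (intro that) auto
qed

lemma sum_geometric_tail_le:
  fixes \<sigma> :: real
  assumes "0 \<le> \<sigma>" "\<sigma> < 1" "finite A" "A \<subseteq> {a..}"
  shows "(\<Sum>j\<in>A. \<sigma> ^ j) \<le> \<sigma> ^ a / (1 - \<sigma>)"
proof -
  obtain M where M: "A \<subseteq> {..<M}"
    using assms(3) finite_nat_iff_bounded by auto
  have "A \<subseteq> (\<lambda>i. i + a) ` {..<M}"
  proof
    fix j assume "j \<in> A"
    then have "a \<le> j" "j < M" using assms(4) M by auto
    then show "j \<in> (\<lambda>i. i + a) ` {..<M}" by (intro image_eqI[of _ _ "j - a"]) auto
  qed
  then have "(\<Sum>j\<in>A. \<sigma> ^ j) \<le> (\<Sum>j\<in>(\<lambda>i. i + a) ` {..<M}. \<sigma> ^ j)"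
    using assms(1) by (intro sum_mono2) auto
  also have "\<dots> = \<sigma> ^ a * (\<Sum>i<M. \<sigma> ^ i)"
    by (subst sum.reindex) (auto simp: power_add sum_distrib_left mult.commute)
  also have "(\<Sum>i<M. \<sigma> ^ i) = (1 - \<sigma> ^ M) / (1 - \<sigma>)"
    using assms(2) by (subst geometric_sum) (auto simp: divide_simps algebra_simps)
  also have "\<sigma> ^ a * ((1 - \<sigma> ^ M) / (1 - \<sigma>)) \<le> \<sigma> ^ a * (1 / (1 - \<sigma>))"
    using assms by (intro mult_left_mono divide_right_mono) auto
  finally show ?thesis by simp
qed

context localised_wavelets
begin

lemma Sigma_bar_separated:
  fixes B s t \<epsilon> :: real
  assumes s: "0 < s" "s < t" and B: "0 < B" and \<epsilon>: "0 < \<epsilon>"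
  obtains c where "0 < c"
    "\<And>m f g. f \<in> Sigma_bar T W B \<epsilon> s m \<Longrightarrow> g \<in> Sigma_class T W B t \<Longrightarrow>
       ereal (c * 2 powr (- real m * s)) \<le> sup_norm T (\<lambda>x. f x - g x)"
proof -
  define P where "P = real N * C"
  define \<sigma> where "\<sigma> = 2 powr (- s)"
  have P: "0 < P" using constants by (simp add: P_def)
  have \<sigma>: "0 < \<sigma>" "\<sigma> < 1" using s by (auto simp: \<sigma>_def powr_less_one)
  have \<sigma>_pow: "\<sigma> ^ j = 2 powr (- real j * s)" for j
    by (simp add: \<sigma>_def powr_power mult.commute)
  \<comment> \<open>The order of the choices matters: first \<open>q\<close> makes the tail from
    level l + q on small through s-smoothness, then \<open>l0\<close>, depending on
    \<open>q\<close>, makes the t-smooth part of the \<open>q\<close> remaining levels small, and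
    finally \<open>c\<close> fixes the share of \<delta>. Each share is at most a quarter of
    \<epsilon> 2^(-l s), and none of the choices involves \<open>m\<close>, \<open>f\<close> or
    \<open>g\<close>.\<close>
  obtain q where q: "1 \<le> q" "P * B / (1 - \<sigma>) * 2 powr (- real q * s) \<le> \<epsilon> / 4"
    using two_powr_small[of s "\<epsilon> / 4" 1 "P * B / (1 - \<sigma>)"] s \<epsilon> by auto
  obtain l0 where l0: "coarse W \<le> l0" "P * real q * B * 2 powr (- real l0 * (t - s)) \<le> \<epsilon> / 4"
    using two_powr_small[of "t - s" "\<epsilon> / 4" "coarse W" "P * real q * B"] s \<epsilon> by auto
  define c where "c = \<epsilon> / (4 * P * real q * (C * D)) * 2 powr (- real l0 * s)"
  have c: "0 < c"
    using \<epsilon> P q(1) constants by (simp add: c_def)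
  have "ereal (c * 2 powr (- real m * s)) \<le> sup_norm T (\<lambda>x. f x - g x)"
    if f: "f \<in> Sigma_bar T W B \<epsilon> s m" and g: "g \<in> Sigma_class T W B t" for m f g
  proof (rule ccontr)
    define \<delta> where "\<delta> = c * 2 powr (- real m * s)"
    define l where "l = m + l0"
    define E where "E = real q * (B * 2 powr (- real l * t) + C * D * \<delta>) + B * \<sigma> ^ (l + q) / (1 - \<sigma>)"
    \<comment> \<open>Below level l + q the comparison with \<open>g\<close> is used, with 2^(-j t)
      replaced by the larger 2^(-l t); from there on, the bound coming from the s-smoothness of
      \<open>f\<close> itself.\<close>
    define e where "e j = (if j < l + q then B * 2 powr (- real l * t) + C * D * \<delta> else B * \<sigma> ^ j)" for j
    assume "\<not> ereal (c * 2 powr (- real m * s)) \<le> sup_norm T (\<lambda>x. f x - g x)"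
    then have "sup_norm T (\<lambda>x. f x - g x) \<le> ereal \<delta>"
      unfolding \<delta>_def by simp
    then have close: "\<bar>f x - g x\<bar> \<le> \<delta>" if "x \<in> T" for x
      using that by (simp add: ereal_sup_norm_le)
    have \<delta>: "0 < \<delta>" using c by (simp add: \<delta>_def)
    have fS: "f \<in> Sigma_class T W B s" using f by (simp add: Sigma_bar_def)
    have l: "coarse W \<le> l" using l0 by (simp add: l_def)
    have "\<bar>partial_sum T W l f x - f x\<bar> \<le> real N * C * E" if "x \<in> T" for x
    proof (rule partial_sum_error[where e = e])
      show "continuous_on T f" "bounded (f ` T)" "set_integrable lborel T f"
        using fS Sigma_class_integrable[OF fS] by (auto simp: Sigma_class_def)
      show "2 powr (real j / 2) * \<bar>beta T W j k f\<bar> \<le> e j" if j: "l \<le> j" and k: "k \<in> psi_index W j" for j k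
      proof (cases "j < l + q")
        case True
        have jc: "coarse W \<le> j" using j l by simp
        have "2 powr (real j / 2) * \<bar>beta T W j k f\<bar> \<le>
          2 powr (real j / 2) * (\<bar>beta T W j k f - beta T W j k g\<bar> + \<bar>beta T W j k g\<bar>)"
          by (intro mult_left_mono) auto
        also have "\<dots> = 2 powr (real j / 2) * \<bar>beta T W j k f - beta T W j k g\<bar> + 2 powr (real j / 2) * \<bar>beta T W j k g\<bar>"
          by (simp add: algebra_simps)
        also have "\<dots> \<le> C * D * \<delta> + B * 2 powr (- real j * t)"
          using beta_diff_le[OF fS g jc k close] Sigma_class_beta[OF g jc k] by (intro add_mono)
        also have "\<dots> \<le> C * D * \<delta> + B * 2 powr (- real l * t)"
          using j s B by (intro add_left_mono mult_left_mono powr_mono) auto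
        finally show ?thesis using True by (simp add: e_def)
      next
        case False
        then show ?thesis
          using Sigma_class_beta[OF fS _ k] j l by (simp add: e_def \<sigma>_pow)
      qed
      show "0 \<le> e j" for j
        using B \<sigma> \<delta> constants by (simp add: e_def)
      show "sum e A \<le> E" if A: "finite A" "A \<subseteq> {l..}" for A
      proof -
        have "sum e A = sum e (A \<inter> {..<l + q}) + sum e (A - {..<l + q})"
          using A(1) by (metis sum.Int_Diff)
        also have "sum e (A \<inter> {..<l + q}) = real (card (A \<inter> {..<l + q})) * (B * 2 powr (- real l * t) + C * D * \<delta>)"
          by (simp add: e_def)
        also have "\<dots> \<le> real q * (B * 2 powr (- real l * t) + C * D * \<delta>)"
        proof (intro mult_right_mono)
          have "card (A \<inter> {..<l + q}) \<le> card {l..<l + q}"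
            using A(2) by (intro card_mono) auto
          then show "real (card (A \<inter> {..<l + q})) \<le> real q" by simp
        qed (use B \<delta> constants in auto)
        also have "sum e (A - {..<l + q}) = B * (\<Sum>j\<in>A - {..<l + q}. \<sigma> ^ j)"
          unfolding sum_distrib_left by (intro sum.cong) (auto simp: e_def)
        also have "\<dots> \<le> B * (\<sigma> ^ (l + q) / (1 - \<sigma>))"
          using A \<sigma> B by (intro mult_left_mono sum_geometric_tail_le) auto
        finally show ?thesis by (simp add: E_def)
      qed
    qed (use l that in auto)
    then have "sup_norm T (\<lambda>x. partial_sum T W l f x - f x) \<le> ereal (P * E)"
      by (simp add: ereal_sup_norm_le P_def)
    moreover have "ereal (\<epsilon> * 2 powr (- real l * s)) \<le> sup_norm T (\<lambda>x. partial_sum T W l f x - f x)"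
      using f unfolding Sigma_bar_def l_def by (auto simp del: of_nat_add)
    ultimately have "\<epsilon> * 2 powr (- real l * s) \<le> P * E"
      using order_trans by fastforce
    moreover have "P * E = P * real q * B * 2 powr (- real l * t) + P * real q * (C * D) * \<delta> +
        P * B / (1 - \<sigma>) * \<sigma> ^ (l + q)"
      by (simp add: E_def algebra_simps add_divide_distrib)
    moreover have "P * real q * B * 2 powr (- real l * t) \<le> \<epsilon> / 4 * 2 powr (- real l * s)"
    proof -
      have "2 powr (- real l * t) = 2 powr (- real l * (t - s)) * 2 powr (- real l * s)"
        by (simp add: powr_add[symmetric] algebra_simps)
      also have "\<dots> \<le> 2 powr (- real l0 * (t - s)) * 2 powr (- real l * s)"
        using s by (intro mult_right_mono powr_mono) (auto simp: l_def)
      finally have "P * real q * B * 2 powr (- real l * t) \<le>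
        P * real q * B * (2 powr (- real l0 * (t - s)) * 2 powr (- real l * s))"
        using P B by (intro mult_left_mono) auto
      also have "\<dots> \<le> \<epsilon> / 4 * 2 powr (- real l * s)"
        unfolding mult.assoc[symmetric] using l0(2) by (intro mult_right_mono) auto
      finally show ?thesis .
    qed
    moreover have "P * real q * (C * D) * \<delta> = \<epsilon> / 4 * 2 powr (- real l * s)"
    proof -
      have "P * real q * (C * D) * \<delta> = \<epsilon> / 4 * (2 powr (- real l0 * s) * 2 powr (- real m * s))"
        using P q(1) constants by (simp add: \<delta>_def c_def field_simps)
      also have "2 powr (- real l0 * s) * 2 powr (- real m * s) = 2 powr (- real l * s)"
        by (simp add: l_def powr_add[symmetric] algebra_simps)
      finally show ?thesis .
    qed
    moreover have "P * B / (1 - \<sigma>) * \<sigma> ^ (l + q) \<le> \<epsilon> / 4 * 2 powr (- real l * s)"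
    proof -
      have "P * B / (1 - \<sigma>) * \<sigma> ^ (l + q) = P * B / (1 - \<sigma>) * 2 powr (- real q * s) * 2 powr (- real l * s)"
        by (simp add: power_add \<sigma>_pow)
      also have "\<dots> \<le> \<epsilon> / 4 * 2 powr (- real l * s)"
        using q(2) by (intro mult_right_mono) auto
      finally show ?thesis .
    qed
    \<comment> \<open>The three contributions add up to at most 3/4 of \<epsilon> 2^(-l s), while
      membership in the class, applicable because l \<ge> m, requires the full amount.\<close>
    moreover have "0 < \<epsilon> * 2 powr (- real l * s)"
      using \<epsilon> by simp
    ultimately show False by linarith
  qed
  with c show thesis by (rule that)
qed

section \<open>Densities with a terminating wavelet series\<close>

lemma Inl_mem_wavelet_indices [simp]: "Inl k \<in> wavelet_indices W \<longleftrightarrow> k \<in> phi_index W"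
  and Inr_mem_wavelet_indices [simp]:
    "Inr (l, k) \<in> wavelet_indices W \<longleftrightarrow> coarse W \<le> l \<and> k \<in> psi_index W l"
  by (auto simp: wavelet_indices_def)

text \<open>The witness is \<open>f\<^sub>0\<close> plus one wavelet at a sufficiently fine level
  \<open>l\<close>. It integrates to 1 because the wavelet has mean zero, and it stays nonnegative
  because \<open>f\<^sub>0\<close> is at least \<mu> where that wavelet lives. Its coefficient has
  the critical size for smoothness s, too large for smoothness t > s; above level \<open>l\<close>
  there are no coefficients at all, so the approximation error vanishes.\<close>

lemma terminating_density_separated:
  fixes B s t \<mu> :: real and f\<^sub>0 :: "real \<Rightarrow> real"
  assumes s: "0 < s" "s < t" and B: "1 \<le> B" and \<mu>: "0 < \<mu>"
    and f0: "continuous_on T f\<^sub>0" "bounded (f\<^sub>0 ` T)" "set_integrable lborel T f\<^sub>0"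
    and f0_nonneg: "\<And>x. x \<in> T \<Longrightarrow> 0 \<le> f\<^sub>0 x"
    and f0_int: "(LINT x:T|lborel. f\<^sub>0 x) = 1"
    and f0_alpha: "\<And>k. k \<in> phi_index W \<Longrightarrow> \<bar>alpha T W k f\<^sub>0\<bar> \<le> 1"
    and f0_beta: "\<And>l k. coarse W \<le> l \<Longrightarrow> k \<in> psi_index W l \<Longrightarrow> beta T W l k f\<^sub>0 = 0"
    and psi_int: "\<And>l k. coarse W \<le> l \<Longrightarrow> k \<in> psi_index W l \<Longrightarrow> (LINT x:T|lborel. psi W l k x) = 0"
    and f0_pos: "\<And>l. coarse W \<le> l \<Longrightarrow> \<exists>k\<in>psi_index W l. \<forall>x\<in>T. psi W l k x \<noteq> 0 \<longrightarrow> \<mu> \<le> f\<^sub>0 x"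
  obtains f \<rho> where "0 < \<rho>" "f \<in> Sigma_class T W B s"
    "\<And>g. g \<in> Sigma_class T W B t \<Longrightarrow> ereal \<rho> \<le> sup_norm T (\<lambda>x. g x - f x)"
    "\<And>m \<epsilon>. 0 < \<epsilon> \<Longrightarrow> f \<notin> Sigma_bar T W B \<epsilon> s m"
proof -
  \<comment> \<open>The bound 1 keeps the new coefficient within the Hoelder ball of radius B \<ge>
    1, the bound \<mu>/C keeps the perturbation below \<mu> in absolute value.\<close>
  define B' where "B' = min 1 (\<mu> / C)"
  have B': "0 < B'" "B' \<le> 1" "B' * C \<le> \<mu>"
    using \<mu> constants by (auto simp: B'_def min_def field_simps)
  \<comment> \<open>At this level the weighted coefficients allowed in the class of smoothness t are
    at most half of the weighted coefficient B' 2^(-l s) about to be inserted.\<close>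
  obtain l where l: "coarse W \<le> l" "B * 2 powr (- real l * (t - s)) \<le> B' / 2"
    using two_powr_small[of "t - s" "B' / 2" "coarse W" B] s B' by auto
  obtain k where k: "k \<in> psi_index W l" "\<And>x. x \<in> T \<Longrightarrow> psi W l k x \<noteq> 0 \<Longrightarrow> \<mu> \<le> f\<^sub>0 x"
    using f0_pos[OF l(1)] by blast
  define \<delta> where "\<delta> = B' * 2 powr (- real l * (s + 1/2))"
  define f where "f x = f\<^sub>0 x + \<delta> * psi W l k x" for x
  have \<delta>: "0 < \<delta>" using B' by (simp add: \<delta>_def)
  have \<delta>_scaled: "2 powr (real l * (s + 1/2)) * \<delta> = B'" "2 powr (real l / 2) * \<delta> = B' * 2 powr (- real l * s)"
    unfolding \<delta>_def by (simp_all add: powr_add[symmetric] algebra_simps mult.left_commute[of _ B'])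
  have small: "\<bar>\<delta> * psi W l k x\<bar> \<le> \<mu>" if "x \<in> T" for x
  proof -
    have "\<bar>\<delta> * psi W l k x\<bar> \<le> \<delta> * (C * 2 powr (real l / 2))"
      unfolding abs_mult using \<delta> psi_bound[OF l(1) k(1) that] by (simp add: mult_left_mono)
    also have "\<dots> = B' * C * 2 powr (- real l * s)"
      using \<delta>_scaled(2) by (simp add: mult.commute mult.left_commute)
    also have "\<dots> \<le> B' * C * 1"
      using B' constants s powr_mono[of "- real l * s" 0 2] by (intro mult_left_mono) auto
    finally show ?thesis using B'(3) by simp
  qed
  have f_int: "set_integrable lborel T f"
    unfolding f_def by (intro set_integral_add(1) f0 set_integrable_mult_right psi_L1(1)[OF l(1) k(1)])
  have f_cont: "continuous_on T f"
    unfolding f_def by (intro continuous_intros f0 psi_cont[OF l(1) k(1)])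
  have f_bdd: "bounded (f ` T)"
  proof -
    obtain M where M: "\<And>x. x \<in> T \<Longrightarrow> \<bar>f\<^sub>0 x\<bar> \<le> M"
      using f0(2) by (auto simp: bounded_iff)
    have "\<bar>f x\<bar> \<le> M + \<mu>" if "x \<in> T" for x
      using M[OF that] small[OF that] unfolding f_def by linarith
    then show ?thesis by (auto simp: bounded_iff)
  qed
  have coeff: "(LINT x:T|lborel. f x * wavelet_family W i x) =
      (LINT x:T|lborel. f\<^sub>0 x * wavelet_family W i x) + \<delta> * (if i = Inr (l, k) then 1 else 0)"
    if i: "i \<in> wavelet_indices W" for i
  proof -
    have lk: "Inr (l, k) \<in> wavelet_indices W"
      using l k by simp
    have u: "l2_function T (wavelet_family W i)" "l2_function T (wavelet_family W (Inr (l, k)))"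
      using orthonormal i lk by (auto simp: orthonormal_family_def)
    have "(LINT x:T|lborel. f x * wavelet_family W i x) =
      (LINT x:T|lborel. f\<^sub>0 x * wavelet_family W i x + \<delta> * (wavelet_family W (Inr (l, k)) x * wavelet_family W i x))"
      by (simp add: f_def wavelet_family_def algebra_simps)
    also have "\<dots> = (LINT x:T|lborel. f\<^sub>0 x * wavelet_family W i x) +
        \<delta> * l2_inner T (wavelet_family W (Inr (l, k))) (wavelet_family W i)"
      unfolding l2_inner_def
      using set_integrable_times_l2[OF f0 u(1)] set_integrable_mult_l2[OF u(2,1) T_borel]
      by (subst set_integral_add(2)) auto
    finally show ?thesis
      using orthonormal i lk by (auto simp: orthonormal_family_def)
  qed
  have f_alpha: "alpha T W k' f = alpha T W k' f\<^sub>0" if "k' \<in> phi_index W" for k'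
    using coeff[of "Inl k'"] that by (simp add: alpha_def wavelet_family_def)
  have f_beta: "beta T W j k' f = (if j = l \<and> k' = k then \<delta> else 0)"
    if "coarse W \<le> j" "k' \<in> psi_index W j" for j k'
    using coeff[of "Inr (j, k')"] f0_beta[OF that] that
    by (auto simp: beta_def wavelet_family_def)
  have f_Sigma: "f \<in> Sigma_class T W B s"
  proof -
    have "0 \<le> f x" if "x \<in> T" for x
      using small[OF that] k(2)[OF that] f0_nonneg[OF that] by (cases "psi W l k x = 0") (auto simp: f_def)
    moreover have "(LINT x:T|lborel. f x) = 1"
      unfolding f_def using psi_int[OF l(1) k(1)] f0_int f0(3) psi_L1(1)[OF l(1) k(1)]
      by (subst set_integral_add(2)) auto
    moreover have "holder_norm T W s f \<le> ereal B"
    proof -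
      have "\<bar>alpha T W k' f\<bar> \<le> B" if "k' \<in> phi_index W" for k'
        using f0_alpha[OF that] B by (simp add: f_alpha[OF that])
      moreover have "2 powr (real j * (s + 1/2)) * \<bar>beta T W j k' f\<bar> \<le> B"
        if "coarse W \<le> j" "k' \<in> psi_index W j" for j k'
        using \<delta>_scaled(1) B' B \<delta> by (simp add: f_beta[OF that])
      ultimately show ?thesis
        unfolding holder_norm_def by (auto intro!: SUP_least)
    qed
    ultimately show ?thesis
      using f_cont f_bdd by (simp add: Sigma_class_def)
  qed
  \<comment> \<open>A function of the smoother class must differ from \<open>f\<close> in this
    weighted coefficient by at least (B'/2) 2^(-l s), whereas distance \<rho> permits only C D
    \<rho>, which is half of that.\<close>
  define \<rho> where "\<rho> = B' * 2 powr (- real l * s) / (4 * C * D)"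
  have \<rho>: "0 < \<rho>" using B' constants by (simp add: \<rho>_def)
  have "ereal \<rho> \<le> sup_norm T (\<lambda>x. g x - f x)" if g: "g \<in> Sigma_class T W B t" for g
  proof (rule ccontr)
    assume "\<not> ereal \<rho> \<le> sup_norm T (\<lambda>x. g x - f x)"
    then have "sup_norm T (\<lambda>x. g x - f x) \<le> ereal \<rho>" by simp
    then have "\<bar>g x - f x\<bar> \<le> \<rho>" if "x \<in> T" for x
      using that by (simp add: ereal_sup_norm_le)
    then have "2 powr (real l / 2) * \<bar>beta T W l k g - beta T W l k f\<bar> \<le> C * D * \<rho>"
      by (rule beta_diff_le[OF g f_Sigma l(1) k(1)])
    moreover have "2 powr (real l / 2) * \<bar>beta T W l k g\<bar> \<le> B * 2 powr (- real l * t)"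
      using Sigma_class_beta[OF g l(1) k(1)] .
    moreover have "B' * 2 powr (- real l * s) \<le>
      2 powr (real l / 2) * \<bar>beta T W l k g - beta T W l k f\<bar> + 2 powr (real l / 2) * \<bar>beta T W l k g\<bar>"
    proof -
      have "B' * 2 powr (- real l * s) = 2 powr (real l / 2) * \<bar>beta T W l k f\<bar>"
        using f_beta[OF l(1) k(1)] \<delta> \<delta>_scaled(2) by simp
      also have "\<dots> \<le> 2 powr (real l / 2) * (\<bar>beta T W l k g - beta T W l k f\<bar> + \<bar>beta T W l k g\<bar>)"
        by (intro mult_left_mono) auto
      finally show ?thesis by (simp add: distrib_left)
    qed
    moreover have "B * 2 powr (- real l * t) \<le> B' / 2 * 2 powr (- real l * s)"
    proof -
      have "B * 2 powr (- real l * t) = B * 2 powr (- real l * (t - s)) * 2 powr (- real l * s)"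
        by (simp add: powr_add[symmetric] algebra_simps)
      also have "\<dots> \<le> B' / 2 * 2 powr (- real l * s)"
        using l(2) by (intro mult_right_mono) auto
      finally show ?thesis .
    qed
    moreover have "C * D * \<rho> = B' / 4 * 2 powr (- real l * s)"
      using constants by (simp add: \<rho>_def)
    moreover have "0 < B' * 2 powr (- real l * s)"
      using B' by simp
    ultimately show False by linarith
  qed
  moreover have "f \<notin> Sigma_bar T W B \<epsilon> s m" if \<epsilon>: "0 < \<epsilon>" for m \<epsilon>
  proof
    assume f: "f \<in> Sigma_bar T W B \<epsilon> s m"
    \<comment> \<open>K_j uses the levels below j only, hence \<open>Suc l\<close>: from there on
      K_j f = f, and the lower bound \<epsilon> 2^(-j s) > 0 fails.\<close>
    define j where "j = max m (Suc l)"
    have "\<bar>partial_sum T W j f x - f x\<bar> \<le> real N * C * 0" if "x \<in> T" for x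
    proof (rule partial_sum_error[where e = "\<lambda>_. 0"])
      show "2 powr (real j' / 2) * \<bar>beta T W j' k' f\<bar> \<le> 0" if "j \<le> j'" "k' \<in> psi_index W j'" for j' k'
        using f_beta[OF _ that(2)] that(1) l(1) by (simp add: j_def)
    qed (use f_cont f_bdd f_int l that in \<open>auto simp: j_def\<close>)
    then have "sup_norm T (\<lambda>x. partial_sum T W j f x - f x) \<le> ereal 0"
      unfolding ereal_sup_norm_le by simp
    moreover have "ereal (\<epsilon> * 2 powr (- real j * s)) \<le> sup_norm T (\<lambda>x. partial_sum T W j f x - f x)"
      using f unfolding Sigma_bar_def j_def by (auto simp del: of_nat_max)
    ultimately have "ereal (\<epsilon> * 2 powr (- real j * s)) \<le> ereal 0"
      by (rule order_trans[rotated])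
    then have "\<epsilon> * 2 powr (- real j * s) \<le> 0"
      by simp
    then show False
      using \<epsilon> by (simp add: mult_le_0_iff)
  qed
  ultimately show thesis
    using \<rho> f_Sigma by (intro that)
qed

end

section \<open>Sums of integer translates and the partition of unity\<close>

lemma continuously_differentiable_times_imp_continuous:
  assumes "continuously_differentiable_times S f"
  shows "continuous_on UNIV f"
proof -
  obtain D where D: "D 0 = f" "\<forall>i<S. \<forall>x. (D i has_real_derivative D (Suc i) x) (at x)"
    "continuous_on UNIV (D S)"
    using assms by (auto simp: continuously_differentiable_times_def)
  show ?thesis
  proof (cases S)
    case 0
    then show ?thesis using D by simp
  next
    case (Suc n)
    then have "(D 0 has_real_derivative D (Suc 0) x) (at x)" for x
      using D(2) by simp
    then have "isCont f x" for x
      unfolding D(1) by (rule DERIV_isCont)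
    then show ?thesis by (simp add: continuous_on_eq_continuous_at)
  qed
qed

locale compact_support =
  fixes p :: nat and \<phi> :: "real \<Rightarrow> real"
  assumes cont: "continuous_on UNIV \<phi>"
    and support: "\<And>x. \<phi> x \<noteq> 0 \<Longrightarrow> 1 - real p \<le> x \<and> x \<le> real p"
begin

lemma cont': "continuous_on A (\<lambda>x. \<phi> (g x))" if "continuous_on A g"
  using continuous_on_compose2[OF cont that] by simp

lemma bounded_fun:
  obtains M where "0 < M" "\<And>x. \<bar>\<phi> x\<bar> \<le> M"
proof -
  have "bounded (\<phi> ` {1 - real p..real p})"
    by (intro compact_imp_bounded compact_continuous_image continuous_on_subset[OF cont]) auto
  then obtain M where M: "\<And>x. x \<in> {1 - real p..real p} \<Longrightarrow> \<bar>\<phi> x\<bar> \<le> M"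
    unfolding bounded_iff real_norm_def by blast
  have "\<bar>\<phi> x\<bar> \<le> max M 1" for x
    using M[of x] support[of x] by (cases "\<phi> x = 0") auto
  then show thesis by (intro that[of "max M 1"]) auto
qed

lemma integrable: "integrable lborel \<phi>"
proof -
  have "integrable lborel (\<lambda>x. indicator {1 - real p..real p} x *\<^sub>R \<phi> x)"
    by (intro borel_integrable_compact continuous_on_subset[OF cont]) auto
  also have "(\<lambda>x. indicator {1 - real p..real p} x *\<^sub>R \<phi> x) = \<phi>"
    using support by (force simp: indicator_def fun_eq_iff)
  finally show ?thesis .
qed

lemma support_int:
  assumes "\<phi> (x - of_int k) \<noteq> 0"
  shows "k \<in> {\<lfloor>x\<rfloor> - int p..\<lfloor>x\<rfloor> + int p}"
  using support[OF assms] by (simp; linarith)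

text \<open>The sum over all integer translates, written over a finite window outside which the
  terms vanish at x, so that no question of summability arises. \<open>shift_sum_eq\<close> allows
  any other sufficiently large finite window.\<close>

definition shift_sum :: "(int \<Rightarrow> real) \<Rightarrow> real \<Rightarrow> real" where
  "shift_sum c x = (\<Sum>k\<in>{\<lfloor>x\<rfloor> - int p..\<lfloor>x\<rfloor> + int p}. c k * \<phi> (x - of_int k))"

lemma shift_sum_eq:
  assumes "finite A" "\<And>k. \<phi> (x - of_int k) \<noteq> 0 \<Longrightarrow> k \<in> A"
  shows "shift_sum c x = (\<Sum>k\<in>A. c k * \<phi> (x - of_int k))"
  unfolding shift_sum_def using assms support_int[of x]
  by (intro sum.mono_neutral_cong) auto

lemma shift_sum_cont: "continuous_on UNIV (shift_sum c)"
proof -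
  have "isCont (shift_sum c) x" for x
  proof -
    \<comment> \<open>The window in the definition jumps with the floor of the argument. Within
      distance 1 of \<open>x\<close> the floor changes by at most 1, so one more index on either
      side gives a window valid on a neighbourhood.\<close>
    let ?A = "{\<lfloor>x\<rfloor> - int p - 1..\<lfloor>x\<rfloor> + int p + 1}"
    have "continuous_on {x - 1<..<x + 1} (shift_sum c)"
    proof (rule continuous_on_eq)
      show "continuous_on {x - 1<..<x + 1} (\<lambda>y. \<Sum>k\<in>?A. c k * \<phi> (y - of_int k))"
        by (intro continuous_intros cont')
      fix y assume "y \<in> {x - 1<..<x + 1}"
      then have "\<lfloor>x\<rfloor> - 1 \<le> \<lfloor>y\<rfloor>" "\<lfloor>y\<rfloor> \<le> \<lfloor>x\<rfloor> + 1"
        by (simp; linarith)+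
      then show "(\<Sum>k\<in>?A. c k * \<phi> (y - of_int k)) = shift_sum c y"
        using support_int[of y] by (intro shift_sum_eq[symmetric]) force+
    qed
    then show ?thesis
      by (rule continuous_on_interior) (auto simp: interior_open)
  qed
  then show ?thesis by (simp add: continuous_on_eq_continuous_at)
qed

end

section \<open>Refinement equation and partition of unity\<close>

locale refinable = compact_support +
  fixes h :: "int \<Rightarrow> real"
  assumes refine: "\<And>x. \<phi> x = sqrt 2 * (\<Sum>k=1 - int p..int p. h k * \<phi> (2 * x - of_int k))"
    and integral_one: "(LINT x|lborel. \<phi> x) = 1"
    and wavelet_mean:
      "(LINT x|lborel. sqrt 2 * (\<Sum>k=1 - int p..int p. (-1) powi k * h (1 - k) * \<phi> (2 * x - of_int k))) = 0"
begin

lemma integral_refine: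
  "(LINT x|lborel. sqrt 2 * (\<Sum>k=1 - int p..int p. a k * \<phi> (2 * x - of_int k))) =
     sqrt 2 * (\<Sum>k=1 - int p..int p. a k) / 2"
proof -
  have "has_bochner_integral lborel (\<lambda>x. \<phi> (- of_int k + 2 * x)) (1 / \<bar>2\<bar>)" for k :: int
    using integrable integral_one lborel_has_bochner_integral_real_affine_iff[of 2 \<phi> 1 "- of_int k"]
    by (simp add: has_bochner_integral_iff)
  then have "has_bochner_integral lborel (\<lambda>x. \<phi> (2 * x - of_int k)) (1 / 2)" for k :: int
    by (simp add: add.commute)
  then have "has_bochner_integral lborel (\<lambda>x. sqrt 2 * (\<Sum>k=1 - int p..int p. a k * \<phi> (2 * x - of_int k)))
     (sqrt 2 * (\<Sum>k=1 - int p..int p. a k * (1 / 2)))"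
    by (intro has_bochner_integral_mult_right has_bochner_integral_sum)
  then show ?thesis
    by (simp add: has_bochner_integral_iff sum_distrib_left sum_divide_distrib)
qed

text \<open>Integrating the refinement equation shows that the filter sums to sqrt 2. The vanishing
  mean of the wavelet, whose filter is the reversed one with alternating signs, shows that the even
  and the odd part are equal.\<close>

lemma filter_parity_sums:
  "(\<Sum>j\<in>{1 - int p..int p} \<inter> {j. even j}. h j) = 1 / sqrt 2"
  "(\<Sum>j\<in>{1 - int p..int p} \<inter> {j. odd j}. h j) = 1 / sqrt 2"
proof -
  let ?H = "{1 - int p..int p}"
  let ?e = "\<Sum>j\<in>?H \<inter> {j. even j}. h j" and ?o = "\<Sum>j\<in>?H \<inter> {j. odd j}. h j"
  have split: "?H = ?H \<inter> {j. even j} \<union> ?H \<inter> {j. odd j}" by auto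
  have "sum h ?H = ?e + ?o"
    by (subst split, rule sum.union_disjoint) auto
  moreover have "sqrt 2 * sum h ?H = 2"
    using integral_refine[of h] unfolding refine[symmetric] integral_one by simp
  ultimately have 1: "sqrt 2 * (?e + ?o) = 2" by simp
  have "(\<Sum>k\<in>?H. (-1) powi k * h (1 - k)) = (\<Sum>j\<in>?H. (-1) powi (1 - j) * h j)"
    by (rule sum.reindex_bij_witness[of _ "\<lambda>j. 1 - j" "\<lambda>k. 1 - k"]) auto
  also have "\<dots> = (\<Sum>j\<in>?H. if even j then - h j else h j)"
    by (intro sum.cong refl) (auto simp: power_int_minus_left)
  also have "\<dots> = - ?e + ?o"
    by (subst split, subst sum.union_disjoint) (auto simp: sum_negf)
  finally have alternating: "(\<Sum>k\<in>?H. (-1) powi k * h (1 - k)) = - ?e + ?o" .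
  have 2: "sqrt 2 * (- ?e + ?o) = 0"
    using integral_refine[of "\<lambda>k. (-1) powi k * h (1 - k)"]
    unfolding wavelet_mean alternating by linarith
  have solve: "e = 1 / sqrt 2 \<and> u = 1 / sqrt 2" if "sqrt 2 * (e + u) = 2" "sqrt 2 * (- e + u) = 0" for e u :: real
  proof -
    have "u = e" using that(2) by simp
    then have "e * sqrt 2 = 1" using that(1) by (simp add: mult.commute)
    then show ?thesis using \<open>u = e\<close> by (simp add: eq_divide_eq)
  qed
  show "?e = 1 / sqrt 2" "?o = 1 / sqrt 2"
    using solve[OF 1 2] by blast+
qed

text \<open>After the refinement equation is inserted, the translate of index n at 2 x collects
  precisely the filter coefficients with the parity of n. For both parities these sum to 1 / sqrt 2,
  which cancels the factor sqrt 2.\<close>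

lemma shift_sum_one_double: "shift_sum (\<lambda>_. 1) x = shift_sum (\<lambda>_. 1) (2 * x)"
proof -
  let ?A = "{\<lfloor>x\<rfloor> - int p..\<lfloor>x\<rfloor> + int p}" and ?B = "{\<lfloor>2 * x\<rfloor> - int p..\<lfloor>2 * x\<rfloor> + int p}"
  let ?H = "{1 - int p..int p}"
  define R where "R b = (\<Sum>n\<in>?B \<inter> {n. even n = b}. \<phi> (2 * x - of_int n))" for b
  have R: "(\<Sum>k\<in>?A. \<phi> (2 * (x - of_int k) - of_int j)) = R (even j)" if j: "j \<in> ?H" for j
  proof -
    have "(\<Sum>k\<in>?A. \<phi> (2 * (x - of_int k) - of_int j)) =
        (\<Sum>n\<in>(\<lambda>k. 2 * k + j) ` ?A. \<phi> (2 * x - of_int n))"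
      by (subst sum.reindex) (auto simp: inj_on_def algebra_simps)
    also have "\<dots> = R (even j)"
      unfolding R_def
    proof (intro sum.mono_neutral_cong ballI)
      fix n assume n: "n \<in> ?B \<inter> {n. even n = even j} - (\<lambda>k. 2 * k + j) ` ?A"
      then have "even (n - j)" by auto
      then obtain k where k: "n = 2 * k + j" by (metis diff_add_cancel evenE)
      then have kA: "k \<notin> ?A" using n by auto
      show "\<phi> (2 * x - of_int n) = 0"
      proof (rule ccontr)
        assume "\<phi> (2 * x - of_int n) \<noteq> 0"
        from support[OF this] have "1 - real p \<le> 2 * x - 2 * of_int k - of_int j"
          "2 * x - 2 * of_int k - of_int j \<le> real p"
          by (simp_all add: k)
        moreover have "1 - real p \<le> of_int j" "of_int j \<le> real p"
          using j by (simp_all; linarith)+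
        ultimately have "x - real p \<le> of_int k" "of_int k \<le> x + real p - 1"
          by linarith+
        then have "k \<in> ?A" by (simp; linarith)
        with kA show False by simp
      qed
    next
      fix n assume "n \<in> (\<lambda>k. 2 * k + j) ` ?A - ?B \<inter> {n. even n = even j}"
      then show "\<phi> (2 * x - of_int n) = 0"
        using support_int[of "2 * x" n] by auto
    qed auto
    finally show ?thesis .
  qed
  have "shift_sum (\<lambda>_. 1) x = (\<Sum>k\<in>?A. sqrt 2 * (\<Sum>j\<in>?H. h j * \<phi> (2 * (x - of_int k) - of_int j)))"
    unfolding shift_sum_def by (subst refine) simp
  also have "\<dots> = sqrt 2 * (\<Sum>j\<in>?H. \<Sum>k\<in>?A. h j * \<phi> (2 * (x - of_int k) - of_int j))"
    by (subst sum.swap) (simp add: sum_distrib_left)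
  also have "\<dots> = sqrt 2 * (\<Sum>j\<in>?H. h j * R (even j))"
    unfolding sum_distrib_left[symmetric] by (simp only: R cong: sum.cong)
  also have "(\<Sum>j\<in>?H. h j * R (even j)) =
      (\<Sum>j\<in>?H \<inter> {j. even j}. h j * R True) + (\<Sum>j\<in>?H \<inter> {j. odd j}. h j * R False)"
  proof -
    have split: "?H = ?H \<inter> {j. even j} \<union> ?H \<inter> {j. odd j}" by auto
    show ?thesis by (subst split, subst sum.union_disjoint) auto
  qed
  also have "sqrt 2 * \<dots> = R True + R False"
    unfolding sum_distrib_right[symmetric] filter_parity_sums by (simp add: field_simps)
  also have "\<dots> = shift_sum (\<lambda>_. 1) (2 * x)"
  proof -
    have split: "?B = ?B \<inter> {n. even n = True} \<union> ?B \<inter> {n. even n = False}" by auto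
    show ?thesis unfolding shift_sum_def R_def
      by (subst (3) split, subst sum.union_disjoint) auto
  qed
  finally show ?thesis .
qed

text \<open>
  The sum \<open>P\<close> of all integer translates satisfies \<open>P x = P (2 x)\<close>, hence \<open>P x = P (x / 2\<^sup>n)\<close>,
  and is therefore constant by continuity at \<open>0\<close>.
\<close>

lemma partition_of_unity: "shift_sum (\<lambda>_. 1) x = 1"
proof -
  let ?P = "shift_sum (\<lambda>_. 1)"
  have const: "?P x = ?P 0" for x
  proof -
    have "?P (x / 2 ^ n) = ?P x" for n
    proof (induction n)
      case (Suc n)
      have "?P (x / 2 ^ Suc n) = ?P (2 * (x / 2 ^ Suc n))"
        by (rule shift_sum_one_double)
      with Suc show ?case by simp
    qed simp
    moreover have "(\<lambda>n. x / 2 ^ n) \<longlonglongrightarrow> 0"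
      using LIMSEQ_divide_realpow_zero[of 2 x] by simp
    then have "(\<lambda>n. ?P (x / 2 ^ n)) \<longlonglongrightarrow> ?P 0"
      using shift_sum_cont by (intro isCont_tendsto_compose[where g = ?P])
        (auto simp: continuous_on_eq_continuous_at)
    ultimately show ?thesis
      by (simp add: LIMSEQ_const_iff)
  qed
  \<comment> \<open>It remains to identify the constant. Cutting the integral of \<phi>, which is 1,
    into the cells [k, k + 1) and moving each of them to [0, 1) turns it into the integral over [0,
    1) of the sum of all translates.\<close>
  let ?A = "{- int p..int p}"
  have int: "has_bochner_integral lborel (\<lambda>x. indicat_real {0..<1} x * \<phi> (x + of_int k))
      (\<integral>x. indicat_real {of_int k..<of_int k + 1} x * \<phi> x \<partial>lborel)" for k :: int
  proof -
    have "integrable lborel (\<lambda>x. indicat_real {of_int k..<of_int k + 1} x * \<phi> x)"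
      using integrable_real_mult_indicator[OF _ integrable, of "{of_int k..<of_int k + 1}"] by (simp add: mult.commute)
    then have "has_bochner_integral lborel (\<lambda>x. indicat_real {of_int k..<of_int k + 1} x * \<phi> x)
        (\<integral>x. indicat_real {of_int k..<of_int k + 1} x * \<phi> x \<partial>lborel)"
      by (rule has_bochner_integral_integrable)
    then show ?thesis
      by (subst (asm) lborel_has_bochner_integral_real_affine_iff[of 1 _ _ "of_int k"])
         (simp_all add: indicator_def add.commute)
  qed
  have "1 = (\<integral>x. (\<Sum>k\<in>?A. indicat_real {of_int k..<of_int k + 1} x * \<phi> x) \<partial>lborel)"
  proof -
    have "(\<Sum>k\<in>?A. indicat_real {of_int k..<of_int k + 1} x * \<phi> x) = \<phi> x" for x
    proof (cases "\<phi> x = 0")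
      case False
      have "\<lfloor>x\<rfloor> \<in> ?A" using support[OF False] by (simp; linarith)
      moreover have "indicat_real {of_int k..<of_int k + 1} x = (if k = \<lfloor>x\<rfloor> then 1 else 0)" for k :: int
        by (auto simp: indicator_def; linarith)
      ultimately show ?thesis by (simp add: sum_distrib_right[symmetric])
    qed simp
    then show ?thesis by (simp only: integral_one)
  qed
  also have "\<dots> = (\<Sum>k\<in>?A. \<integral>x. indicat_real {of_int k..<of_int k + 1} x * \<phi> x \<partial>lborel)"
    using integrable_real_mult_indicator[OF _ integrable] by (intro Bochner_Integration.integral_sum) (simp add: mult.commute)
  also have "\<dots> = (\<integral>x. (\<Sum>k\<in>?A. indicat_real {0..<1} x * \<phi> (x + of_int k)) \<partial>lborel)"
    using has_bochner_integral_sum[OF int] by (rule has_bochner_integral_integral_eq[symmetric])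
  also have "\<dots> = (\<integral>x. indicat_real {0..<1::real} x * ?P 0 \<partial>lborel)"
  proof (rule arg_cong[where f = "integral\<^sup>L lborel"], rule ext)
    fix x :: real
    have "(\<Sum>k\<in>?A. \<phi> (x + of_int k)) = ?P x" if x: "x \<in> {0..<1}"
    proof -
      have "\<lfloor>x\<rfloor> = 0" using x by (simp add: floor_eq_iff)
      have "(\<Sum>k\<in>?A. \<phi> (x + of_int k)) = (\<Sum>k\<in>?A. 1 * \<phi> (x - of_int k))"
        by (rule sum.reindex_bij_witness[of _ uminus uminus]) auto
      also have "\<dots> = ?P x"
        using \<open>\<lfloor>x\<rfloor> = 0\<close> by (simp add: shift_sum_def)
      finally show ?thesis .
    qed
    then show "(\<Sum>k\<in>?A. indicat_real {0..<1} x * \<phi> (x + of_int k)) = indicat_real {0..<1} x * ?P 0"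
      by (cases "x \<in> {0..<1}") (simp_all add: const[of x])
  qed
  also have "\<dots> = ?P 0"
    by simp
  finally show ?thesis using const[of x] by simp
qed

end

section \<open>Daubechies wavelets on the line\<close>

lemma card_support_le:
  assumes "compact_support p \<phi>"
  shows "finite {k::int. \<phi> (y - of_int k) \<noteq> 0}" "card {k::int. \<phi> (y - of_int k) \<noteq> 0} \<le> 2 * p + 1"
proof -
  interpret compact_support p \<phi> by fact
  have sub: "{k::int. \<phi> (y - of_int k) \<noteq> 0} \<subseteq> {\<lfloor>y\<rfloor> - int p..\<lfloor>y\<rfloor> + int p}"
    using support_int by blast
  show "finite {k::int. \<phi> (y - of_int k) \<noteq> 0}"
    by (rule finite_subset[OF sub]) simp
  show "card {k::int. \<phi> (y - of_int k) \<noteq> 0} \<le> 2 * p + 1"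
    using card_mono[OF _ sub] by simp
qed

lemma finite_int_abs_le: "finite {k::int. \<bar>of_int k\<bar> \<le> (c::real)}"
proof (rule finite_subset)
  show "{k::int. \<bar>of_int k\<bar> \<le> c} \<subseteq> {- \<lceil>c\<rceil>..\<lceil>c\<rceil>}"
    by (auto simp: abs_le_iff; linarith)
qed simp

lemma finite_local_translates:
  assumes "compact_support p \<phi>" "0 < a"
  shows "finite {k::int. \<exists>x\<in>T. \<bar>x\<bar> \<le> r \<and> \<phi> (a * x - of_int k) \<noteq> 0}"
proof (rule finite_subset[OF _ finite_int_abs_le[of "a * r + real p"]], clarify)
  interpret compact_support p \<phi> by fact
  fix k :: int and x :: real
  assume "\<bar>x\<bar> \<le> r" and nz: "\<phi> (a * x - of_int k) \<noteq> 0"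
  then have "\<bar>a * x\<bar> \<le> a * r"
    using assms(2) by (simp add: abs_mult mult_left_mono)
  then show "\<bar>of_int k\<bar> \<le> a * r + real p"
    using support[OF nz] by linarith
qed

lemma daubechies_pairD:
  assumes pair: "daubechies_pair S p \<phi> \<psi>" and S: "0 < S"
  shows "1 \<le> p" "compact_support p \<phi>" "compact_support p \<psi>"
    "(LINT x|lborel. \<psi> x) = 0" "\<exists>h. refinable p \<phi> h"
proof -
  note d = pair[unfolded daubechies_pair_def]
  have "S \<le> p" and diff: "continuously_differentiable_times S \<phi>" "continuously_differentiable_times S \<psi>"
    and supp: "\<And>x. x \<notin> {1 - real p..real p} \<Longrightarrow> \<phi> x = 0 \<and> \<psi> x = 0"
    and moments: "\<And>i. i < p \<Longrightarrow> (LINT x|lborel. x ^ i * \<psi> x) = 0"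
    using d by blast+
  show p: "1 \<le> p" using \<open>S \<le> p\<close> S by simp
  have supp': "\<phi> x \<noteq> 0 \<or> \<psi> x \<noteq> 0 \<Longrightarrow> 1 - real p \<le> x \<and> x \<le> real p" for x
    using supp[of x] by auto
  show \<phi>: "compact_support p \<phi>" and "compact_support p \<psi>"
    using continuously_differentiable_times_imp_continuous[OF diff(1)]
      continuously_differentiable_times_imp_continuous[OF diff(2)] supp'
    by (simp_all add: compact_support_def)
  \<comment> \<open>Since p \<ge> S > 0, the zeroth moment is among those that vanish.\<close>
  have "(LINT x|lborel. x ^ 0 * \<psi> x) = 0"
    using p by (intro moments) simp
  then show \<psi>: "(LINT x|lborel. \<psi> x) = 0" by simp
  obtain h where h: "\<And>x. \<phi> x = sqrt 2 * (\<Sum>k=1 - int p..int p. h k * \<phi> (2 * x - of_int k))"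
    "\<And>x. \<psi> x = sqrt 2 * (\<Sum>k=1 - int p..int p. (-1) powi k * h (1 - k) * \<phi> (2 * x - of_int k))"
    using d by blast
  have "refinable p \<phi> h"
  proof (intro refinable.intro \<phi> refinable_axioms.intro)
    show "(LINT x|lborel. \<phi> x) = 1" using d by blast
    show "(LINT x|lborel. sqrt 2 * (\<Sum>k=1 - int p..int p. (-1) powi k * h (1 - k) * \<phi> (2 * x - of_int k))) = 0"
      using \<psi> unfolding h(2)[symmetric] .
  qed (rule h(1))
  then show "\<exists>h. refinable p \<phi> h" by blast
qed

lemma dilated_support:
  assumes "compact_support p \<psi>" "\<psi> (2 ^ l * x - c) \<noteq> 0"
  shows "x \<in> {(c + 1 - real p) / 2 ^ l..(c + 1 - real p) / 2 ^ l + 2 * real p / 2 ^ l}"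
proof -
  have "1 - real p \<le> 2 ^ l * x - c" "2 ^ l * x - c \<le> real p"
    using compact_support.support[OF assms] by auto
  moreover have "(c + 1 - real p) / 2 ^ l + 2 * real p / 2 ^ l = (c + 1 + real p) / 2 ^ l"
    by (simp add: add_divide_distrib[symmetric])
  ultimately show ?thesis
    by (simp add: divide_le_eq le_divide_eq mult.commute)
qed

lemma localised_wavelets_line:
  assumes basis: "daubechies_basis_line S W" and S: "0 < S"
  obtains C D N where "localised_wavelets UNIV W C D N"
proof -
  obtain p \<phi> \<psi> where pair: "daubechies_pair S p \<phi> \<psi>" and W: "coarse W = 0" "phi_index W = UNIV"
    "phi W = (\<lambda>k x. \<phi> (x - of_int k))" "psi_index W = (\<lambda>l. UNIV)"
    "psi W = (\<lambda>l k x. 2 powr (real l / 2) * \<psi> (2 ^ l * x - of_int k))"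
    using basis by (auto simp: daubechies_basis_line_def)
  note p = daubechies_pairD[OF pair S]
  interpret f: compact_support p \<phi> by (rule p)
  interpret w: compact_support p \<psi> by (rule p)
  obtain M where M: "0 < M" "\<And>x. \<bar>\<psi> x\<bar> \<le> M"
    using w.bounded_fun by blast
  have "localised_wavelets UNIV W M (2 * real p) (2 * p + 1)"
  proof
    show "orthonormal_basis_L2 UNIV (wavelet_indices W) (wavelet_family W)"
      using basis by (simp add: daubechies_basis_line_def)
    show "continuous_on UNIV (phi W k)" for k
      unfolding W by (intro f.cont' continuous_intros)
    show "continuous_on UNIV (psi W l k)" for l k
      unfolding W by (intro continuous_intros w.cont')
    show "finite {k \<in> phi_index W. \<exists>x\<in>UNIV. \<bar>x\<bar> \<le> r \<and> phi W k x \<noteq> 0}" for r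
      using finite_local_translates[OF p(2), of 1 UNIV r] by (simp add: W)
    show "finite {k \<in> psi_index W l. \<exists>x\<in>UNIV. \<bar>x\<bar> \<le> r \<and> psi W l k x \<noteq> 0}" for l r
      using finite_local_translates[OF p(3), of "2 ^ l" UNIV r] by (simp add: W)
    show "\<bar>psi W l k x\<bar> \<le> M * 2 powr (real l / 2)" for l k x
      using M(2) by (simp add: W abs_mult mult.commute mult_right_mono)
    show "card {k \<in> psi_index W l. psi W l k x \<noteq> 0} \<le> 2 * p + 1" for l x
      using card_support_le(2)[OF p(3)] by (simp add: W)
    show "\<exists>a. \<forall>x\<in>UNIV. psi W l k x \<noteq> 0 \<longrightarrow> x \<in> {a..a + 2 * real p / 2 ^ l}" for l k
      unfolding W using dilated_support[OF p(3)]
      by (intro exI[of _ "(of_int k + 1 - real p) / 2 ^ l"]) simp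
  qed (use M p in auto)
  then show thesis by (rule that)
qed

section \<open>A positive density on the line\<close>

lemma integrable_exp_minus_abs:
  fixes a :: real
  assumes "0 < a"
  shows "integrable lborel (\<lambda>x. exp (- a * \<bar>x\<bar>))"
proof -
  let ?h = "\<lambda>x. indicat_real {0..} x * exp (- a * x)"
  have "(\<lambda>x. exp (- a * x)) absolutely_integrable_on {0..}"
    using has_integral_exp_minus_to_infinity[OF assms, of 0]
    by (intro nonnegative_absolutely_integrable_1) (auto simp: integrable_on_def)
  then have h: "integrable lborel ?h"
    unfolding set_integrable_def by (subst (asm) integrable_completion) simp_all
  have h': "integrable lborel (\<lambda>x. ?h (0 + (-1) * x))"
    by (rule lborel_integrable_real_affine[OF h]) simp
  show ?thesis
    by (rule Bochner_Integration.integrable_bound[OF Bochner_Integration.integrable_add[OF h h']])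
       (auto simp: indicator_def abs_if)
qed

text \<open>Against a function of bounded support the sum of translates is finite with an index set
  independent of the point, so it can be integrated term by term. \<open>K\<close> forces in those
  indices that must not be lost when a particular term is picked out later.\<close>

lemma (in compact_support) shift_sum_on_support:
  assumes "\<And>x. u x \<noteq> 0 \<Longrightarrow> \<bar>x\<bar> \<le> r" and K: "finite K"
  obtains A where "finite A" "K \<subseteq> A"
    "\<And>c x. shift_sum c x * u x = (\<Sum>k\<in>A. c k * (\<phi> (x - of_int k) * u x))"
proof
  let ?A = "{k::int. \<bar>of_int k\<bar> \<le> r + real p} \<union> K"
  show "finite ?A" using K finite_int_abs_le by blast
  show "K \<subseteq> ?A" by blast
  fix c x
  show "shift_sum c x * u x = (\<Sum>k\<in>?A. c k * (\<phi> (x - of_int k) * u x))"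
  proof (cases "u x = 0")
    case False
    have "shift_sum c x = (\<Sum>k\<in>?A. c k * \<phi> (x - of_int k))"
    proof (rule shift_sum_eq[OF \<open>finite ?A\<close>])
      fix k assume "\<phi> (x - of_int k) \<noteq> 0"
      from support[OF this] assms(1)[OF False] have "\<bar>of_int k\<bar> \<le> r + real p" by linarith
      then show "k \<in> ?A" by blast
    qed
    then show ?thesis by (simp add: sum_distrib_right mult.assoc)
  qed simp
qed

text \<open>
  The coefficients \<open>exp (- a \<bar>k\<bar>)\<close> vary so slowly for small \<open>a\<close> that, by the partition of unity,
  the sum is comparable to \<open>exp (- a \<bar>\<lfloor>x\<rfloor>\<bar>)\<close>, although \<open>\<phi>\<close> itself may take negative values.
\<close>

lemma (in refinable) shift_sum_exp_bounds:
  assumes p: "1 \<le> p"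
  obtains a where "0 < a" "a \<le> 1 / 10"
    "\<And>x. exp (- a * \<bar>of_int \<lfloor>x\<rfloor>\<bar>) / 2 \<le> shift_sum (\<lambda>k. exp (- a * \<bar>of_int k\<bar>)) x"
    "\<And>x. shift_sum (\<lambda>k. exp (- a * \<bar>of_int k\<bar>)) x \<le> 2 * exp (- a * \<bar>of_int \<lfloor>x\<rfloor>\<bar>)"
proof -
  obtain M where M: "0 < M" "\<And>x. \<bar>\<phi> x\<bar> \<le> M"
    using bounded_fun by blast
  \<comment> \<open>A window contains 2 p + 1 translates, each bounded by \<open>M\<close>; this
    relative error of the coefficients costs exactly half of the main term.\<close>
  define \<eta> where "\<eta> = 1 / (2 * (2 * real p + 1) * M)"
  have \<eta>: "0 < \<eta>" using M by (simp add: \<eta>_def)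
  \<comment> \<open>The logarithm keeps the relative change of the coefficients over p indices below
    \<eta>. The bound 1/10 has a separate purpose: it makes the integral of the sum at least
    1.\<close>
  define a where "a = min (1 / 10) (ln (1 + \<eta>) / real p)"
  have a: "0 < a" using \<eta> p by (auto simp: a_def)
  have a_le: "a \<le> 1 / 10" unfolding a_def by (rule min.cobounded1)
  have "a * real p \<le> ln (1 + \<eta>)"
    using p by (simp add: a_def min_def field_simps)
  then have exp_ap: "exp (a * real p) - 1 \<le> \<eta>"
    using \<eta> by (simp add: ln_ge_iff)
  define c where "c k = exp (- a * \<bar>of_int k\<bar>)" for k :: int
  have c_diff: "\<bar>c k - c m\<bar> \<le> c m * \<eta>" if "\<bar>k - m\<bar> \<le> int p" for k m
  proof -
    have km: "\<bar>of_int k\<bar> - \<bar>of_int m\<bar> \<le> real p" "\<bar>of_int m\<bar> - \<bar>of_int k\<bar> \<le> real p"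
      using that by linarith+
    have "c k \<le> c m * exp (a * real p)"
      using mult_left_mono[OF km(2), of a] a by (simp add: c_def exp_add[symmetric] algebra_simps)
    also have "\<dots> \<le> c m * (1 + \<eta>)"
      using exp_ap by (intro mult_left_mono) (auto simp: c_def)
    finally have 1: "c k \<le> c m + c m * \<eta>" by (simp add: algebra_simps)
    have "c m * exp (- (a * real p)) \<le> c k"
      using mult_left_mono[OF km(1), of a] a by (simp add: c_def exp_add[symmetric] algebra_simps)
    moreover have "1 - \<eta> \<le> exp (- (a * real p))"
    proof -
      have "a * real p \<le> \<eta>"
        using exp_ge_add_one_self[of "a * real p"] exp_ap by linarith
      then show ?thesis
        using exp_ge_add_one_self[of "- (a * real p)"] by linarith
    qed
    then have "c m * (1 - \<eta>) \<le> c m * exp (- (a * real p))"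
      by (intro mult_left_mono) (auto simp: c_def)
    ultimately have 2: "c m - c m * \<eta> \<le> c k" by (simp add: algebra_simps)
    show ?thesis using 1 2 by (simp add: abs_le_iff)
  qed
  have bound: "\<bar>shift_sum c x - c \<lfloor>x\<rfloor>\<bar> \<le> c \<lfloor>x\<rfloor> / 2" for x
  proof -
    let ?A = "{\<lfloor>x\<rfloor> - int p..\<lfloor>x\<rfloor> + int p}"
    \<comment> \<open>The partition of unity lets the constant \<open>c \<lfloor>x\<rfloor>\<close>
      be distributed over the translates, so that only differences of nearby coefficients
      remain.\<close>
    have "shift_sum c x - c \<lfloor>x\<rfloor> = shift_sum c x - c \<lfloor>x\<rfloor> * shift_sum (\<lambda>_. 1) x"
      by (simp add: partition_of_unity)
    also have "\<dots> = (\<Sum>k\<in>?A. (c k - c \<lfloor>x\<rfloor>) * \<phi> (x - of_int k))"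
      by (simp add: shift_sum_def sum_distrib_left sum_subtractf left_diff_distrib)
    finally have "\<bar>shift_sum c x - c \<lfloor>x\<rfloor>\<bar> \<le> (\<Sum>k\<in>?A. \<bar>(c k - c \<lfloor>x\<rfloor>) * \<phi> (x - of_int k)\<bar>)"
      by (simp add: sum_abs)
    also have "\<dots> \<le> (\<Sum>k\<in>?A. c \<lfloor>x\<rfloor> * \<eta> * M)"
    proof (rule sum_mono)
      fix k assume "k \<in> ?A"
      then have "\<bar>c k - c \<lfloor>x\<rfloor>\<bar> \<le> c \<lfloor>x\<rfloor> * \<eta>"
        by (intro c_diff) auto
      then show "\<bar>(c k - c \<lfloor>x\<rfloor>) * \<phi> (x - of_int k)\<bar> \<le> c \<lfloor>x\<rfloor> * \<eta> * M"
        unfolding abs_mult using M \<eta> by (intro mult_mono) (auto simp: c_def)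
    qed
    also have "\<dots> = c \<lfloor>x\<rfloor> * ((2 * real p + 1) * (\<eta> * M))"
      by simp
    also have "(2 * real p + 1) * (\<eta> * M) = 1 / 2"
      using M(1) by (simp add: \<eta>_def divide_simps)
    finally show ?thesis by simp
  qed
  have "c \<lfloor>x\<rfloor> / 2 \<le> shift_sum c x \<and> shift_sum c x \<le> 2 * c \<lfloor>x\<rfloor>" for x
  proof -
    have "0 < c \<lfloor>x\<rfloor>" by (simp add: c_def)
    with bound[of x] show ?thesis by linarith
  qed
  then show thesis
    using a a_le by (intro that[of a]) (auto simp: c_def[abs_def])
qed

lemma separated_density_line:
  fixes B s t :: real
  assumes line: "daubechies_basis_line S W" and S: "0 < S"
    and s: "0 < s" "s < t" and B: "1 \<le> B"
  obtains f \<rho> where "0 < \<rho>" "f \<in> Sigma_class UNIV W B s"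
    "\<And>g. g \<in> Sigma_class UNIV W B t \<Longrightarrow> ereal \<rho> \<le> sup_norm UNIV (\<lambda>x. g x - f x)"
    "\<And>m \<epsilon>. 0 < \<epsilon> \<Longrightarrow> f \<notin> Sigma_bar UNIV W B \<epsilon> s m"
proof -
  obtain C D N where "localised_wavelets UNIV W C D N"
    using localised_wavelets_line[OF line S] .
  then interpret localised_wavelets UNIV W C D N .
  obtain p \<phi> \<psi> where pair: "daubechies_pair S p \<phi> \<psi>" and W: "coarse W = 0" "phi_index W = UNIV"
    "phi W = (\<lambda>k x. \<phi> (x - of_int k))" "psi_index W = (\<lambda>l. UNIV)"
    "psi W = (\<lambda>l k x. 2 powr (real l / 2) * \<psi> (2 ^ l * x - of_int k))"
    using line by (auto simp: daubechies_basis_line_def)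
  note p = daubechies_pairD[OF pair S]
  obtain h where "refinable p \<phi> h" using p(5) by blast
  then interpret f: refinable p \<phi> h .
  interpret w: compact_support p \<psi> by (rule p)
  obtain a where a: "0 < a" "a \<le> 1 / 10"
    "\<And>x. exp (- a * \<bar>of_int \<lfloor>x\<rfloor>\<bar>) / 2 \<le> f.shift_sum (\<lambda>k. exp (- a * \<bar>of_int k\<bar>)) x"
    "\<And>x. f.shift_sum (\<lambda>k. exp (- a * \<bar>of_int k\<bar>)) x \<le> 2 * exp (- a * \<bar>of_int \<lfloor>x\<rfloor>\<bar>)"
    using f.shift_sum_exp_bounds[OF p(1)] by blast
  define c where "c k = exp (- a * \<bar>of_int k\<bar>)" for k :: int
  let ?g = "f.shift_sum c"
  have g: "c \<lfloor>x\<rfloor> / 2 \<le> ?g x" "?g x \<le> 2 * c \<lfloor>x\<rfloor>" for x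
    using a(3,4) by (simp_all add: c_def[abs_def])
  have g_pos: "0 < ?g x" for x
    by (rule less_le_trans[OF _ g(1)]) (simp add: c_def)
  have g_cont: "continuous_on UNIV ?g"
    by (rule f.shift_sum_cont)
  have g_int: "integrable lborel ?g"
  proof (rule Bochner_Integration.integrable_bound)
    show "integrable lborel (\<lambda>x. 2 * exp a * exp (- a * \<bar>x\<bar>))"
      by (intro integrable_mult_right integrable_exp_minus_abs a)
    show "?g \<in> borel_measurable lborel"
      using borel_measurable_continuous_onI[OF g_cont] by simp
    have "?g x \<le> 2 * exp a * exp (- a * \<bar>x\<bar>)" for x
    proof -
      have "\<bar>x\<bar> - 1 \<le> \<bar>of_int \<lfloor>x\<rfloor>\<bar>" by linarith
      from mult_left_mono[OF this, of a] have "c \<lfloor>x\<rfloor> \<le> exp a * exp (- a * \<bar>x\<bar>)"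
        using a by (simp add: c_def exp_add[symmetric] algebra_simps)
      with g(2)[of x] show ?thesis by simp
    qed
    then show "AE x in lborel. norm (?g x) \<le> norm (2 * exp a * exp (- a * \<bar>x\<bar>))"
      using g_pos by (simp add: less_imp_le)
  qed
  define Z where "Z = (\<integral>x. ?g x \<partial>lborel)"
  \<comment> \<open>Normalising by Z \<ge> 1 keeps the scaling coefficients c_k / Z at most 1. On
    [-3, 3) the sum is at least exp (-3 a) / 2, which contributes 3 exp (-3 a) \<ge> 3 (1 - 3 a) to
    the integral.\<close>
  have Z: "1 \<le> Z"
  proof -
    have "1 \<le> 3 * (1 - 3 * a)"
      using a by simp
    also have "\<dots> \<le> 3 * exp (- 3 * a)"
      using exp_ge_add_one_self[of "- 3 * a"] by simp
    also have "\<dots> = (\<integral>x. exp (- 3 * a) / 2 * indicat_real {-3..<3::real} x \<partial>lborel)"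
      by simp
    also have "\<dots> \<le> Z"
      unfolding Z_def
    proof (rule integral_mono[OF _ g_int])
      show "integrable lborel (\<lambda>x. exp (- 3 * a) / 2 * indicat_real {-3..<3::real} x)"
        by (intro integrable_mult_right integrable_real_indicator) auto
      fix x :: real
      show "exp (- 3 * a) / 2 * indicat_real {-3..<3::real} x \<le> ?g x"
      proof (cases "x \<in> {-3..<3::real}")
        case True
        then have "-3 \<le> x" "x < 3" by auto
        then have "- 3 \<le> \<lfloor>x\<rfloor>" "\<lfloor>x\<rfloor> \<le> 3" by linarith+
        then have "\<bar>\<lfloor>x\<rfloor>\<bar> \<le> 3" by linarith
        then have "\<bar>of_int \<lfloor>x\<rfloor>\<bar> \<le> (3::real)" by linarith
        then have "exp (- 3 * a) \<le> c \<lfloor>x\<rfloor>" using a by (simp add: c_def)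
        with g(1)[of x] True show ?thesis by simp
      next
        case False
        then show ?thesis using g_pos[of x] by simp
      qed
    qed
    finally show ?thesis .
  qed
  define f0 where "f0 x = ?g x / Z" for x
  have f0_eq: "f0 = f.shift_sum (\<lambda>k. c k / Z)"
    by (simp add: f0_def f.shift_sum_def fun_eq_iff sum_divide_distrib)
  \<comment> \<open>By orthonormality the expansion coefficients are those used in the construction;
    in particular no wavelet occurs in \<open>f0\<close>.\<close>
  have coeff: "(LINT x:UNIV|lborel. f0 x * wavelet_family W i x) =
      (case i of Inl k \<Rightarrow> c k / Z | Inr _ \<Rightarrow> 0)"
    if i: "i \<in> wavelet_indices W" for i
  proof -
    define K where "K = (case i of Inl k \<Rightarrow> {k} | Inr _ \<Rightarrow> {})"
    have "\<exists>r. \<forall>x. wavelet_family W i x \<noteq> 0 \<longrightarrow> \<bar>x\<bar> \<le> r"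
    proof (cases i)
      case (Inl k)
      have "\<bar>x\<bar> \<le> \<bar>of_int k\<bar> + real p" if "wavelet_family W i x \<noteq> 0" for x
        using that f.support[of "x - of_int k"] by (simp add: Inl wavelet_family_def W; linarith)
      then show ?thesis by blast
    next
      case (Inr lk)
      obtain l k where lk: "lk = (l, k)" by (cases lk)
      let ?u = "(of_int k + 1 - real p) / 2 ^ l" and ?v = "2 * real p / 2 ^ l"
      have "\<bar>x\<bar> \<le> \<bar>?u\<bar> + \<bar>?v\<bar>" if "wavelet_family W i x \<noteq> 0" for x
      proof -
        have "x \<in> {?u..?u + ?v}"
          using that by (intro dilated_support[OF p(3)]) (simp add: Inr lk wavelet_family_def W)
        then show ?thesis by (simp only: atLeastAtMost_iff; linarith)
      qed
      then show ?thesis by blast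
    qed
    then obtain r where r: "\<And>x. wavelet_family W i x \<noteq> 0 \<Longrightarrow> \<bar>x\<bar> \<le> r" by blast
    have "finite K" by (simp add: K_def split: sum.splits)
    obtain A where A: "finite A" "K \<subseteq> A"
      "\<And>c x. f.shift_sum c x * wavelet_family W i x = (\<Sum>k\<in>A. c k * (\<phi> (x - of_int k) * wavelet_family W i x))"
      using f.shift_sum_on_support[of "wavelet_family W i", OF r \<open>finite K\<close>] by blast
    have mem: "Inl k \<in> wavelet_indices W" for k
      by (simp add: W)
    have inner: "l2_inner UNIV (wavelet_family W (Inl k)) (wavelet_family W i) = (if Inl k = i then 1 else 0)" for k
      using orthonormal mem[of k] i by (auto simp: orthonormal_family_def)
    have "has_bochner_integral lborel
        (\<lambda>x. indicator UNIV x *\<^sub>R (wavelet_family W (Inl k) x * wavelet_family W i x))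
        (l2_inner UNIV (wavelet_family W (Inl k)) (wavelet_family W i))" for k
      unfolding l2_inner_def set_lebesgue_integral_def
      using set_integrable_mult_l2[of UNIV "wavelet_family W (Inl k)" "wavelet_family W i"]
        orthonormal mem[of k] i
      by (intro has_bochner_integral_integrable) (auto simp: orthonormal_family_def set_integrable_def)
    then have "has_bochner_integral lborel (\<lambda>x. \<phi> (x - of_int k) * wavelet_family W i x)
        (if Inl k = i then 1 else 0)" for k
      unfolding inner by (simp add: wavelet_family_def W)
    then have "has_bochner_integral lborel
        (\<lambda>x. \<Sum>k\<in>A. c k / Z * (\<phi> (x - of_int k) * wavelet_family W i x))
        (\<Sum>k\<in>A. c k / Z * (if Inl k = i then 1 else 0))"
      by (intro has_bochner_integral_sum has_bochner_integral_mult_right)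
    then have "(LINT x:UNIV|lborel. f0 x * wavelet_family W i x) = (\<Sum>k\<in>A. c k / Z * (if Inl k = i then 1 else 0))"
      unfolding f0_eq A(3) set_lebesgue_integral_def by (simp add: has_bochner_integral_iff)
    also have "\<dots> = (case i of Inl k \<Rightarrow> c k / Z | Inr _ \<Rightarrow> 0)"
    proof (cases i)
      case (Inl m)
      then have "m \<in> A" using A(2) by (simp add: K_def)
      have "(\<Sum>k\<in>A. c k / Z * (if Inl k = i then 1 else 0)) = (\<Sum>k\<in>A. if k = m then c k / Z else 0)"
        by (intro sum.cong) (auto simp: Inl)
      with \<open>m \<in> A\<close> A(1) show ?thesis by (simp add: Inl)
    qed simp
    finally show ?thesis .
  qed
  have psi_int: "(LINT x:UNIV|lborel. psi W l k x) = 0" for l k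
  proof -
    have "0 = (2 ^ l) * (\<integral>x. \<psi> (- of_int k + 2 ^ l * x) \<partial>lborel)"
      using lborel_integral_real_affine[of "2 ^ l" \<psi> "- of_int k"] p(4) by simp
    then have "(\<integral>x. \<psi> (2 ^ l * x - of_int k) \<partial>lborel) = 0"
      by (simp add: add.commute)
    then show ?thesis by (simp add: set_lebesgue_integral_def W)
  qed
  \<comment> \<open>The wavelet with k = 0 lives in [-p, p] at every level, where the floor is at
    most p + 1 in absolute value; this gives a lower bound for the density that is uniform in the
    level.\<close>
  let ?\<mu> = "exp (- a * (real p + 1)) / (2 * Z)"
  show thesis
  proof (rule terminating_density_separated[where B = B and s = s and t = t and \<mu> = ?\<mu> and f\<^sub>0 = f0])
    show "0 < ?\<mu>" using Z by simp
    show "continuous_on UNIV f0"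
      unfolding f0_eq by (rule f.shift_sum_cont)
    have "\<bar>f0 x\<bar> \<le> 2" for x
    proof -
      have "c \<lfloor>x\<rfloor> \<le> 1" using a by (simp add: c_def)
      then have "?g x \<le> 2" using g(2)[of x] by simp
      also have "2 \<le> 2 * Z" using Z by simp
      finally show ?thesis using g_pos[of x] Z by (simp add: f0_def divide_le_eq)
    qed
    then show "bounded (range f0)" by (auto simp: bounded_iff)
    show "set_integrable lborel UNIV f0"
      using g_int by (simp add: set_integrable_def f0_def)
    show "0 \<le> f0 x" for x
      using g_pos[of x] Z by (simp add: f0_def)
    show "(LINT x:UNIV|lborel. f0 x) = 1"
      using Z by (simp add: set_lebesgue_integral_def f0_def Z_def[symmetric])
    show "\<bar>alpha UNIV W k f0\<bar> \<le> 1" if "k \<in> phi_index W" for k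
    proof -
      have "0 < c k" "c k \<le> 1" using a by (simp_all add: c_def)
      moreover have "alpha UNIV W k f0 = c k / Z"
        using coeff[of "Inl k"] that by (simp add: alpha_def wavelet_family_def)
      ultimately show ?thesis using Z by (simp add: divide_le_eq)
    qed
    show "beta UNIV W l k f0 = 0" if "coarse W \<le> l" "k \<in> psi_index W l" for l k
      using coeff[of "Inr (l, k)"] that by (simp add: beta_def wavelet_family_def)
    show "\<exists>k\<in>psi_index W l. \<forall>x\<in>UNIV. psi W l k x \<noteq> 0 \<longrightarrow> ?\<mu> \<le> f0 x" for l
    proof (intro bexI[of _ 0] ballI impI)
      fix x assume "psi W l 0 x \<noteq> 0"
      then have "\<psi> (2 ^ l * x) \<noteq> 0" by (simp add: W)
      then have "\<bar>2 ^ l * x\<bar> \<le> real p" using w.support[of "2 ^ l * x"] by linarith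
      moreover have "1 * \<bar>x\<bar> \<le> \<bar>2 ^ l * x\<bar>"
        unfolding abs_mult by (intro mult_right_mono) auto
      ultimately have "\<bar>of_int \<lfloor>x\<rfloor>\<bar> \<le> real p + 1" by linarith
      from mult_left_mono[OF this, of a] have "exp (- a * (real p + 1)) \<le> c \<lfloor>x\<rfloor>"
        using a by (simp add: c_def)
      then have "exp (- a * (real p + 1)) / 2 \<le> ?g x" using g(1)[of x] by simp
      from divide_right_mono[OF this, of Z] show "?\<mu> \<le> f0 x"
        using Z by (simp add: f0_def)
    qed (simp add: W)
  qed (use s B psi_int that in auto)
qed

section \<open>Boundary-corrected wavelets on the unit interval\<close>

text \<open>By continuity the set where \<phi> is nonzero is open, hence contained in the interior
  of the support interval. The strictness excludes two translates that belong to neither edge space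
  in \<open>one_in_span\<close>.\<close>

lemma (in compact_support) support_strict:
  assumes "\<phi> x \<noteq> 0"
  shows "1 - real p < x \<and> x < real p"
proof -
  have "open {x. \<phi> x \<noteq> 0}"
    using cont by (intro open_Collect_neq) auto
  moreover have "{x. \<phi> x \<noteq> 0} \<subseteq> {1 - real p..real p}"
    using support by auto
  ultimately have "{x. \<phi> x \<noteq> 0} \<subseteq> interior {1 - real p..real p}"
    by (rule interior_maximal[rotated])
  then show ?thesis using assms by auto
qed

lemma interval_family_cases:
  assumes "k \<in> {1..2 ^ j}" "2 * int p \<le> 2 ^ j"
  obtains (left) "k \<in> {1..int p}"
      "interval_family p L M R j k = (\<lambda>x. 2 powr (real j / 2) * L k (2 ^ j * x))"
  | (inner) "k \<in> {int p + 1..2 ^ j - int p}"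
      "interval_family p L M R j k = (\<lambda>x. 2 powr (real j / 2) * M (2 ^ j * x - of_int (k - 1)))"
  | (right) "k \<in> {2 ^ j - int p + 1..2 ^ j}" "2 ^ j + 1 - k \<in> {1..int p}"
      "interval_family p L M R j k = (\<lambda>x. 2 powr (real j / 2) * R (2 ^ j + 1 - k) (2 ^ j * (x - 1)))"
proof -
  consider "k \<le> int p" | "int p < k" "k \<le> 2 ^ j - int p" | "int p < k" "2 ^ j - int p < k"
    by linarith
  then show thesis
  proof cases
    case 1
    then show thesis using assms by (intro left) (auto simp: interval_family_def)
  next
    case 2
    then show thesis using assms by (intro inner) (auto simp: interval_family_def)
  next
    case 3
    then show thesis using assms by (intro right) (auto simp: interval_family_def)
  qed
qed

lemma interval_family_cont:
  assumes k: "k \<in> {1..2 ^ j}" "2 * int p \<le> 2 ^ j"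
    and L: "\<And>k. k \<in> {1..int p} \<Longrightarrow> continuous_on {0..} (L k)"
    and M: "continuous_on UNIV M"
    and R: "\<And>k. k \<in> {1..int p} \<Longrightarrow> continuous_on {..0} (R k)"
  shows "continuous_on {0..1} (interval_family p L M R j k)"
  using k
proof (cases rule: interval_family_cases[where L = L and M = M and R = R])
  case left
  show ?thesis
    unfolding left(2)
    by (intro continuous_intros continuous_on_compose2[OF L[OF left(1)]]) auto
next
  case inner
  show ?thesis
    unfolding inner(2)
    by (intro continuous_intros continuous_on_compose2[OF M]) auto
next
  case right
  show ?thesis
    unfolding right(3)
    by (intro continuous_intros continuous_on_compose2[OF R[OF right(2)]])
       (auto simp: mult_le_0_iff)
qed

lemma spans_edge_space_cont:
  assumes "spans_edge_space p \<phi> A H e" "compact_support p' \<phi>" "k \<in> {1..int p}"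
  shows "continuous_on H (e k)"
proof -
  interpret compact_support p' \<phi> by fact
  obtain a where a: "\<And>x. x \<in> H \<Longrightarrow>
      e k x = (\<Sum>i<p. a i * (\<Sum>m\<in>A. of_int m ^ i * \<phi> (x - of_int m)))"
    using bspec[OF conjunct1[OF assms(1)[unfolded spans_edge_space_def]] assms(3)] by blast
  show ?thesis
  proof (rule continuous_on_eq)
    show "continuous_on H (\<lambda>x. \<Sum>i<p. a i * (\<Sum>m\<in>A. of_int m ^ i * \<phi> (x - of_int m)))"
      by (intro continuous_intros cont')
  qed (simp add: a)
qed

lemma spans_edge_space_sum:
  assumes "spans_edge_space p \<phi> A H e" "1 \<le> p"
  obtains a where "\<And>x. x \<in> H \<Longrightarrow> (\<Sum>m\<in>A. \<phi> (x - of_int m)) = (\<Sum>k=1..int p. a k * e k x)"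
proof -
  \<comment> \<open>The edge function with exponent 0 is the plain sum of translates, as
    \<open>of_int m ^ 0\<close> is 1 also for m = 0.\<close>
  have "\<exists>a. \<forall>x\<in>H. (\<Sum>m\<in>A. of_int m ^ 0 * \<phi> (x - of_int m)) = (\<Sum>k=1..int p. a k * e k x)"
    using conjunct2[OF assms(1)[unfolded spans_edge_space_def], rule_format, of 0] assms(2) by simp
  then show thesis using that by auto
qed

lemma sum_int_split:
  fixes a b c :: int and g :: "int \<Rightarrow> real"
  assumes "a \<le> b + 1" "b \<le> c"
  shows "sum g {a..c} = sum g {a..b} + sum g {b + 1..c}"
proof -
  have "{a..c} = {a..b} \<union> {b + 1..c}" using assms by auto
  then show ?thesis by (simp add: sum.union_disjoint)
qed

section \<open>Size, support and mean of the boundary-corrected wavelets\<close>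

locale boundary_corrected =
  fixes S p :: nat and \<phi> \<psi> :: "real \<Rightarrow> real" and \<phi>L \<phi>R \<psi>L \<psi>R :: "int \<Rightarrow> real \<Rightarrow> real" and J :: nat
  assumes pair: "daubechies_pair S p \<phi> \<psi>" and S: "0 < S" and J: "2 * p \<le> 2 ^ J"
    and edge_left: "spans_edge_space p \<phi> {1 - int p..int p - 1} {0..} \<phi>L"
    and edge_right: "spans_edge_space p \<phi> {- int p..int p - 2} {..0} \<phi>R"
    and edge_psi: "\<And>k x. k \<in> {1..int p} \<Longrightarrow> 2 * real p - 1 < x \<Longrightarrow> \<psi>L k x = 0 \<and> \<psi>R k (- x) = 0"
    and mra: "interval_multiresolution J (interval_family p \<phi>L \<phi> \<phi>R) (interval_family p \<psi>L \<psi> \<psi>R)"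
begin

abbreviation "\<Phi> \<equiv> interval_family p \<phi>L \<phi> \<phi>R"
abbreviation "\<Psi> \<equiv> interval_family p \<psi>L \<psi> \<psi>R"

lemma p: "1 \<le> p" and \<phi>: "compact_support p \<phi>" and \<psi>: "compact_support p \<psi>"
  using daubechies_pairD[OF pair S] by auto

sublocale f: compact_support p \<phi> by (rule \<phi>)
sublocale w: compact_support p \<psi> by (rule \<psi>)

lemma level: "J \<le> j \<Longrightarrow> 2 * int p \<le> 2 ^ j"
proof -
  assume "J \<le> j"
  then have "(2::nat) ^ J \<le> 2 ^ j" by (simp add: power_increasing)
  then have "2 * p \<le> 2 ^ j" using J by linarith
  then have "int (2 * p) \<le> int (2 ^ j)" by (simp only: of_nat_le_iff)
  then show ?thesis by simp
qed

lemma Phi_cont: "J \<le> j \<Longrightarrow> k \<in> {1..2 ^ j} \<Longrightarrow> continuous_on {0..1} (\<Phi> j k)"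
  by (intro interval_family_cont level f.cont
      spans_edge_space_cont[OF edge_left \<phi>] spans_edge_space_cont[OF edge_right \<phi>])

text \<open>The edge wavelets are specified only through the multiresolution; they inherit
  continuity from the scaling functions of the next finer level.\<close>

lemma Psi_cont:
  assumes "J \<le> j" "k \<in> {1..2 ^ j}"
  shows "continuous_on {0..1} (\<Psi> j k)"
proof -
  obtain a where a: "\<And>x. x \<in> {0..1} \<Longrightarrow> \<Psi> j k x = (\<Sum>k=1..2 ^ Suc j. a k * \<Phi> (Suc j) k x)"
    using conjunct2[OF mra[unfolded interval_multiresolution_def, rule_format, OF assms(1)], rule_format,
        of "\<Psi> j k"] assms(2) by blast
  show ?thesis
  proof (rule continuous_on_eq)
    show "continuous_on {0..1} (\<lambda>x. \<Sum>k=1..2 ^ Suc j. a k * \<Phi> (Suc j) k x)"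
      using assms(1) by (intro continuous_intros Phi_cont) auto
  qed (simp add: a)
qed

text \<open>The edge functions are the same at all levels, so one bound suffices. It is read off at
  the coarsest level \<open>J\<close>, where continuity on a compact interval controls them for
  arguments up to 2^J in absolute value; beyond that they vanish, since 2 p - 1 < 2^J.\<close>

lemma Psi_bounded:
  obtains C where "0 < C"
    "\<And>j k x. J \<le> j \<Longrightarrow> k \<in> {1..2 ^ j} \<Longrightarrow> x \<in> {0..1} \<Longrightarrow> \<bar>\<Psi> j k x\<bar> \<le> C * 2 powr (real j / 2)"
proof -
  have "\<exists>M. \<forall>x\<in>{0..1}. \<bar>\<Psi> J k x\<bar> \<le> M" if "k \<in> {1..2 ^ J}" for k
  proof -
    have "bounded (\<Psi> J k ` {0..1})"
      by (intro compact_imp_bounded compact_continuous_image Psi_cont that) auto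
    then show ?thesis unfolding bounded_iff real_norm_def by blast
  qed
  then obtain M where M: "\<And>k x. k \<in> {1..2 ^ J} \<Longrightarrow> x \<in> {0..1} \<Longrightarrow> \<bar>\<Psi> J k x\<bar> \<le> M k"
    by metis
  define M' where "M' = (\<Sum>k\<in>{1..2 ^ J}. \<bar>M k\<bar>)"
  have M': "\<bar>\<Psi> J k x\<bar> \<le> M'" if "k \<in> {1..2 ^ J}" "x \<in> {0..1}" for k x
  proof -
    have "\<bar>M k\<bar> \<le> M'"
      unfolding M'_def using that(1) by (intro member_le_sum) auto
    with M[OF that] show ?thesis by linarith
  qed
  have scale: "1 \<le> 2 powr (real J / 2)" by (intro ge_one_powr_ge_zero) auto
  have L: "\<bar>\<psi>L k y\<bar> \<le> M'" if k: "k \<in> {1..int p}" and y: "0 \<le> y" for k y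
  proof (cases "y \<le> 2 ^ J")
    case True
    have "k \<in> {1..2 ^ J}" using k level[of J] by auto
    moreover have "y / 2 ^ J \<in> {0..1}" using y True by simp
    ultimately have "\<bar>\<Psi> J k (y / 2 ^ J)\<bar> \<le> M'" by (rule M')
    then have "2 powr (real J / 2) * \<bar>\<psi>L k y\<bar> \<le> M'"
      using k by (simp add: interval_family_def abs_mult)
    moreover have "1 * \<bar>\<psi>L k y\<bar> \<le> 2 powr (real J / 2) * \<bar>\<psi>L k y\<bar>"
      using scale by (intro mult_right_mono) auto
    ultimately show ?thesis by simp
  next
    case False
    have "real (2 * p) \<le> real (2 ^ J)" using J by (simp only: of_nat_le_iff)
    then have "\<psi>L k y = 0"
      using edge_psi[OF k, of y] False by simp
    then show ?thesis by (simp add: M'_def sum_nonneg)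
  qed
  have R: "\<bar>\<psi>R k y\<bar> \<le> M'" if k: "k \<in> {1..int p}" and y: "y \<le> 0" for k y
  proof (cases "- y \<le> 2 ^ J")
    case True
    have k': "2 ^ J + 1 - k \<in> {1..2 ^ J}" "int p < 2 ^ J + 1 - k" "2 ^ J - int p < 2 ^ J + 1 - k"
      using k level[of J] by auto
    moreover have "1 + y / 2 ^ J \<in> {0..1}"
      using y True by (simp add: field_simps)
    ultimately have "\<bar>\<Psi> J (2 ^ J + 1 - k) (1 + y / 2 ^ J)\<bar> \<le> M'"
      by (intro M')
    then have "2 powr (real J / 2) * \<bar>\<psi>R k y\<bar> \<le> M'"
      using k' by (simp add: interval_family_def abs_mult)
    moreover have "1 * \<bar>\<psi>R k y\<bar> \<le> 2 powr (real J / 2) * \<bar>\<psi>R k y\<bar>"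
      using scale by (intro mult_right_mono) auto
    ultimately show ?thesis by simp
  next
    case False
    have "real (2 * p) \<le> real (2 ^ J)" using J by (simp only: of_nat_le_iff)
    then have "\<psi>R k y = 0"
      using edge_psi[OF k, of "- y"] False by simp
    then show ?thesis by (simp add: M'_def sum_nonneg)
  qed
  obtain N where N: "0 < N" "\<And>x. \<bar>\<psi> x\<bar> \<le> N"
    using w.bounded_fun by blast
  let ?C = "max M' N"
  have "\<bar>\<Psi> j k x\<bar> \<le> ?C * 2 powr (real j / 2)" if "J \<le> j" and k: "k \<in> {1..2 ^ j}" and x: "x \<in> {0..1}" for j k x
    using k level[OF \<open>J \<le> j\<close>]
  proof (cases rule: interval_family_cases[where L = \<psi>L and M = \<psi> and R = \<psi>R])
    case left
    have "\<bar>\<psi>L k (2 ^ j * x)\<bar> \<le> ?C"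
      using L[OF left(1), of "2 ^ j * x"] x by simp
    then show ?thesis
      unfolding left(2) by (simp add: abs_mult mult.commute mult_right_mono)
  next
    case inner
    have "\<bar>\<psi> (2 ^ j * x - of_int (k - 1))\<bar> \<le> ?C"
      using N(2) by (simp add: max.coboundedI2)
    then show ?thesis
      unfolding inner(2) by (simp add: abs_mult mult.commute mult_right_mono)
  next
    case right
    have "\<bar>\<psi>R (2 ^ j + 1 - k) (2 ^ j * (x - 1))\<bar> \<le> ?C"
      using R[OF right(2), of "2 ^ j * (x - 1)"] x by (simp add: mult_le_0_iff)
    then show ?thesis
      unfolding right(3) by (simp add: abs_mult mult.commute mult_right_mono)
  qed
  then show thesis
    using N(1) by (intro that[of ?C]) auto
qed

lemma Psi_support:
  assumes "J \<le> j" and k: "k \<in> {1..2 ^ j}"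
  shows "\<exists>a. \<forall>x\<in>{0..1}. \<Psi> j k x \<noteq> 0 \<longrightarrow> x \<in> {a..a + 2 * real p / 2 ^ j}"
  using k level[OF assms(1)]
proof (cases rule: interval_family_cases[where L = \<psi>L and M = \<psi> and R = \<psi>R])
  case left
  have "x \<in> {0..0 + 2 * real p / 2 ^ j}" if "x \<in> {0..1}" "\<Psi> j k x \<noteq> 0" for x
  proof -
    have "\<psi>L k (2 ^ j * x) \<noteq> 0" using that(2) left(2) by simp
    then have "2 ^ j * x \<le> 2 * real p - 1"
      using edge_psi[OF left(1), of "2 ^ j * x"] by force
    then show ?thesis using that(1) by (simp add: le_divide_eq mult.commute)
  qed
  then show ?thesis by blast
next
  case inner
  have "x \<in> {(of_int (k - 1) + 1 - real p) / 2 ^ j..(of_int (k - 1) + 1 - real p) / 2 ^ j + 2 * real p / 2 ^ j}"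
    if "\<Psi> j k x \<noteq> 0" for x
  proof -
    have "\<psi> (2 ^ j * x - of_int (k - 1)) \<noteq> 0" using that inner(2) by simp
    then show ?thesis by (rule dilated_support[OF \<psi>])
  qed
  then show ?thesis by blast
next
  case right
  have "x \<in> {1 - 2 * real p / 2 ^ j..1 - 2 * real p / 2 ^ j + 2 * real p / 2 ^ j}"
    if "x \<in> {0..1}" "\<Psi> j k x \<noteq> 0" for x
  proof -
    have "\<psi>R (2 ^ j + 1 - k) (2 ^ j * (x - 1)) \<noteq> 0" using that(2) right(3) by simp
    then have "2 ^ j * (1 - x) \<le> 2 * real p - 1"
      using edge_psi[OF right(2), of "2 ^ j * (1 - x)"] by (force simp: algebra_simps)
    then have "1 - x \<le> 2 * real p / 2 ^ j"
      by (simp add: le_divide_eq mult.commute)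
    then show ?thesis using that(1) by simp
  qed
  then show ?thesis by blast
qed

lemma Psi_card:
  assumes "J \<le> j"
  shows "card {k \<in> {1..2 ^ j}. \<Psi> j k x \<noteq> 0} \<le> 4 * p + 1"
proof -
  let ?I = "{k. \<psi> (2 ^ j * x + 1 - of_int k) \<noteq> 0}"
  \<comment> \<open>The 2 p edge indices, and at most 2 p + 1 translates that are nonzero at the
    point. The shift by 1 inside \<open>?I\<close> reflects that index k belongs to translation k -
    1.\<close>
  let ?U = "{1..int p} \<union> {2 ^ j - int p + 1..2 ^ j} \<union> ?I"
  have fin: "finite ?I" using card_support_le(1)[OF \<psi>] .
  have "{k \<in> {1..2 ^ j}. \<Psi> j k x \<noteq> 0} \<subseteq> ?U"
  proof clarify
    fix k assume k: "k \<in> {1..2 ^ j}" and nz: "\<Psi> j k x \<noteq> 0" "\<psi> (2 ^ j * x + 1 - of_int k) = 0"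
      and nr: "k \<notin> {2 ^ j - int p + 1..2 ^ j}" and nl: "k \<notin> {1..int p}"
    show False
      using k level[OF assms]
    proof (cases rule: interval_family_cases[where L = \<psi>L and M = \<psi> and R = \<psi>R])
      case inner
      then show False using nz by (simp add: algebra_simps)
    qed (use nr nl in auto)
  qed
  then have "card {k \<in> {1..2 ^ j}. \<Psi> j k x \<noteq> 0} \<le> card ?U"
    using fin by (intro card_mono) auto
  also have "\<dots> \<le> card {1..int p} + card {2 ^ j - int p + 1..2 ^ j} + card ?I"
    by (intro order_trans[OF card_Un_le] add_mono card_Un_le order_refl)
  also have "\<dots> \<le> p + p + (2 * p + 1)"
    using card_support_le(2)[OF \<psi>] by (intro add_mono) auto
  finally show ?thesis by simp
qed

text \<open>At scale 2^j the partition of unity on the line, restricted to the interval, splits into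
  the translates near 0, the interior ones and those near 1. The two outer groups are the edge
  functions of exponent 0, hence lie in the edge spaces.\<close>

lemma one_in_span:
  assumes "J \<le> j"
  obtains b where "\<And>x. x \<in> {0..1} \<Longrightarrow> 1 = (\<Sum>k=1..2 ^ j. b k * \<Phi> j k x)"
proof -
  obtain h where "refinable p \<phi> h"
    using daubechies_pairD(5)[OF pair S] by blast
  then interpret r: refinable p \<phi> h .
  obtain aL where aL: "\<And>y. 0 \<le> y \<Longrightarrow>
      (\<Sum>m\<in>{1 - int p..int p - 1}. \<phi> (y - of_int m)) = (\<Sum>k=1..int p. aL k * \<phi>L k y)"
    by (rule spans_edge_space_sum[OF edge_left p]) auto
  obtain aR where aR: "\<And>y. y \<le> 0 \<Longrightarrow>
      (\<Sum>m\<in>{- int p..int p - 2}. \<phi> (y - of_int m)) = (\<Sum>k=1..int p. aR k * \<phi>R k y)"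
    by (rule spans_edge_space_sum[OF edge_right p]) auto
  \<comment> \<open>Coefficients for the three groups in the order of the index k; the right edge
    functions are counted from the end. The factor in \<open>b\<close> removes the normalisation
    2^(j/2).\<close>
  define d where "d k = (if k \<le> int p then aL k else if k \<le> 2 ^ j - int p then 1 else aR (2 ^ j + 1 - k))" for k
  define b where "b k = 2 powr (- (real j / 2)) * d k" for k
  have b: "b k * (2 powr (real j / 2) * z) = d k * z" for k z
  proof -
    have "b k * (2 powr (real j / 2) * z) = (2 powr (- (real j / 2)) * 2 powr (real j / 2)) * (d k * z)"
      by (simp only: b_def ac_simps)
    then show ?thesis by (simp add: powr_add[symmetric])
  qed
  have lev: "2 * int p \<le> 2 ^ j" by (rule level[OF assms])
  have "1 = (\<Sum>k=1..2 ^ j. b k * \<Phi> j k x)" if x: "x \<in> {0..1}" for x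
  proof -
    define y where "y = 2 ^ j * x"
    have y: "0 \<le> y" "y \<le> 2 ^ j" using x by (auto simp: y_def)
    let ?f = "\<lambda>m::int. \<phi> (y - of_int m)" and ?t = "\<lambda>k. b k * \<Phi> j k x"
    have "1 = f.shift_sum (\<lambda>_. 1) y" by (simp add: r.partition_of_unity)
    \<comment> \<open>For 0 \<le> y \<le> 2^j, strictness of the support leaves exactly the left
      edge set, the interior indices p, ..., 2^j - p - 1, and the right edge set shifted by
      2^j.\<close>
    also have "\<dots> = (\<Sum>m\<in>{1 - int p..2 ^ j + int p - 2}. 1 * ?f m)"
    proof (rule f.shift_sum_eq)
      fix m :: int assume "\<phi> (y - of_int m) \<noteq> 0"
      from f.support_strict[OF this] y have "- real p < of_int m" "of_int m < 2 ^ j + real p - 1"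
        by linarith+
      then have "of_int (- int p) < (of_int m :: real)" "(of_int m :: real) < of_int (2 ^ j + int p - 1)"
        by simp_all
      then have "- int p < m" "m < 2 ^ j + int p - 1"
        by (simp_all only: of_int_less_iff)
      then show "m \<in> {1 - int p..2 ^ j + int p - 2}" by simp
    qed simp
    also have "\<dots> = sum ?f {1 - int p..int p - 1} + sum ?f {int p..2 ^ j - int p - 1} +
        sum ?f {2 ^ j - int p..2 ^ j + int p - 2}"
      using lev p sum_int_split[of "1 - int p" "2 ^ j - int p - 1" "2 ^ j + int p - 2" ?f]
        sum_int_split[of "1 - int p" "int p - 1" "2 ^ j - int p - 1" ?f] by simp
    also have "sum ?f {1 - int p..int p - 1} = sum ?t {1..int p}"
      unfolding aL[OF y(1)]
      by (intro sum.cong) (auto simp: interval_family_def b d_def y_def)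
    also have "sum ?f {int p..2 ^ j - int p - 1} = sum ?t {int p + 1..2 ^ j - int p}"
      by (rule sum.reindex_bij_witness[of _ "\<lambda>k. k - 1" "\<lambda>m. m + 1"])
         (auto simp: interval_family_def b d_def y_def)
    also have "sum ?f {2 ^ j - int p..2 ^ j + int p - 2} = (\<Sum>m\<in>{- int p..int p - 2}. \<phi> ((y - 2 ^ j) - of_int m))"
      by (rule sum.reindex_bij_witness[of _ "\<lambda>m. m + 2 ^ j" "\<lambda>m. m - 2 ^ j"]) auto
    also have "\<dots> = (\<Sum>k=1..int p. aR k * \<phi>R k (y - 2 ^ j))"
      using y by (intro aR) simp
    also have "\<dots> = sum ?t {2 ^ j - int p + 1..2 ^ j}"
    proof (rule sum.reindex_bij_witness[of _ "\<lambda>k. 2 ^ j + 1 - k" "\<lambda>k. 2 ^ j + 1 - k"])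
      fix k assume k: "k \<in> {1..int p}"
      have "y - 2 ^ j = 2 ^ j * (x - 1)" by (simp add: y_def algebra_simps)
      then show "?t (2 ^ j + 1 - k) = aR k * \<phi>R k (y - 2 ^ j)"
        using k lev by (simp add: interval_family_def b d_def)
    qed auto
    also have "sum ?t {1..int p} + sum ?t {int p + 1..2 ^ j - int p} + sum ?t {2 ^ j - int p + 1..2 ^ j} =
        (\<Sum>k=1..2 ^ j. ?t k)"
    proof -
      have "1 \<le> 2 ^ j - int p + 1" "2 ^ j - int p \<le> 2 ^ j" "1 \<le> int p + 1" "int p \<le> 2 ^ j - int p"
        using lev by linarith+
      then show ?thesis
        by (simp only: sum_int_split[of 1 "2 ^ j - int p" "2 ^ j" ?t] sum_int_split[of 1 "int p" "2 ^ j - int p" ?t])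
    qed
    finally show ?thesis .
  qed
  then show thesis by (rule that)
qed

text \<open>The wavelets of level j are orthogonal to the scaling functions of the same level, whose
  span contains the constant 1.\<close>

lemma Psi_mean:
  assumes "J \<le> j" "k \<in> {1..2 ^ j}"
  shows "(LINT x:{0..1}|lborel. \<Psi> j k x) = 0"
proof -
  obtain b where b: "\<And>x. x \<in> {0..1} \<Longrightarrow> 1 = (\<Sum>k=1..2 ^ j. b k * \<Phi> j k x)"
    using one_in_span[OF assms(1)] by blast
  have on: "orthonormal_family {0..1} ({1..2 ^ j} <+> {1..2 ^ j}) (case_sum (\<Phi> j) (\<Psi> j))"
    using mra assms(1) by (simp add: interval_multiresolution_def)
  have "has_bochner_integral lborel (\<lambda>x. indicator {0..1} x *\<^sub>R (\<Phi> j m x * \<Psi> j k x)) 0"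
    if m: "m \<in> {1..2 ^ j}" for m
  proof -
    have mem: "Inl m \<in> {1..2 ^ j} <+> {1..2 ^ j}" "Inr k \<in> {1..2 ^ j} <+> {1..2 ^ j}"
      using m assms(2) by (auto intro: InlI InrI)
    note l2 = bspec[OF conjunct1[OF on[unfolded orthonormal_family_def]]]
    have "set_integrable lborel {0..1} (\<lambda>x. \<Phi> j m x * \<Psi> j k x)"
      using l2[OF mem(1)] l2[OF mem(2)] by (intro set_integrable_mult_l2) auto
    moreover have "l2_inner {0..1} (\<Phi> j m) (\<Psi> j k) = 0"
      using bspec[OF bspec[OF conjunct2[OF on[unfolded orthonormal_family_def]] mem(1)] mem(2)] by simp
    ultimately show ?thesis
      by (simp only: l2_inner_def set_lebesgue_integral_def set_integrable_def has_bochner_integral_iff)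
  qed
  then have "has_bochner_integral lborel
     (\<lambda>x. \<Sum>m=1..2 ^ j. b m * (indicator {0..1} x *\<^sub>R (\<Phi> j m x * \<Psi> j k x))) (\<Sum>m\<in>{1..2 ^ j::int}. b m * 0)"
    by (intro has_bochner_integral_sum has_bochner_integral_mult_right)
  moreover have "(\<Sum>m=1..2 ^ j. b m * (indicator {0..1} x *\<^sub>R (\<Phi> j m x * \<Psi> j k x))) =
      indicator {0..1} x *\<^sub>R \<Psi> j k x" for x
  proof (cases "x \<in> {0..1}")
    case True
    have "(\<Sum>m=1..2 ^ j. b m * (\<Phi> j m x * \<Psi> j k x)) = (\<Sum>m=1..2 ^ j. b m * \<Phi> j m x) * \<Psi> j k x"
      by (simp add: sum_distrib_right mult.assoc)
    then show ?thesis using True by (simp add: b[OF True, symmetric])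
  qed simp
  ultimately show ?thesis
    by (simp add: set_lebesgue_integral_def has_bochner_integral_iff)
qed

end

lemma daubechies_basis_intervalE:
  assumes "daubechies_basis_interval S W" "0 < S"
  obtains p \<phi> \<psi> \<phi>L \<phi>R \<psi>L \<psi>R where "boundary_corrected S p \<phi> \<psi> \<phi>L \<phi>R \<psi>L \<psi>R (coarse W)"
    "phi_index W = {1..2 ^ coarse W}" "phi W = interval_family p \<phi>L \<phi> \<phi>R (coarse W)"
    "psi_index W = (\<lambda>l. {1..2 ^ l})" "psi W = interval_family p \<psi>L \<psi> \<psi>R"
proof -
  obtain p \<phi> \<psi> \<phi>L \<phi>R \<psi>L \<psi>R where *: "daubechies_pair S p \<phi> \<psi>" "2 * p \<le> 2 ^ coarse W"
      "spans_edge_space p \<phi> {1 - int p..int p - 1} {0..} \<phi>L"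
      "spans_edge_space p \<phi> {- int p..int p - 2} {..0} \<phi>R"
      "\<forall>k\<in>{1..int p}. \<forall>x>2 * real p - 1. \<psi>L k x = 0 \<and> \<psi>R k (- x) = 0"
      "interval_multiresolution (coarse W) (interval_family p \<phi>L \<phi> \<phi>R) (interval_family p \<psi>L \<psi> \<psi>R)"
      "phi_index W = {1..2 ^ coarse W}" "phi W = interval_family p \<phi>L \<phi> \<phi>R (coarse W)"
      "psi_index W = (\<lambda>l. {1..2 ^ l})" "psi W = interval_family p \<psi>L \<psi> \<psi>R"
    using conjunct1[OF assms(1)[unfolded daubechies_basis_interval_def Let_def]] by (elim exE conjE)
  have "boundary_corrected S p \<phi> \<psi> \<phi>L \<phi>R \<psi>L \<psi>R (coarse W)"
    using *(1-6) assms(2) unfolding boundary_corrected_def by blast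
  then show thesis using *(7-10) by (rule that)
qed

lemma localised_wavelets_interval:
  assumes interval: "daubechies_basis_interval S W" and S: "0 < S"
  obtains C D N where "localised_wavelets {0..1} W C D N"
proof -
  obtain p \<phi> \<psi> \<phi>L \<phi>R \<psi>L \<psi>R where bc: "boundary_corrected S p \<phi> \<psi> \<phi>L \<phi>R \<psi>L \<psi>R (coarse W)"
    and W: "phi_index W = {1..2 ^ coarse W}" "phi W = interval_family p \<phi>L \<phi> \<phi>R (coarse W)"
    "psi_index W = (\<lambda>l. {1..2 ^ l})" "psi W = interval_family p \<psi>L \<psi> \<psi>R"
    using daubechies_basis_intervalE[OF interval S] .
  interpret boundary_corrected S p \<phi> \<psi> \<phi>L \<phi>R \<psi>L \<psi>R "coarse W" by (rule bc)
  obtain C where C: "0 < C" "\<And>j k x. coarse W \<le> j \<Longrightarrow> k \<in> {1..2 ^ j} \<Longrightarrow> x \<in> {0..1} \<Longrightarrow>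
      \<bar>\<Psi> j k x\<bar> \<le> C * 2 powr (real j / 2)"
    using Psi_bounded by blast
  have "localised_wavelets {0..1} W C (2 * real p) (4 * p + 1)"
  proof
    show "orthonormal_basis_L2 {0..1} (wavelet_indices W) (wavelet_family W)"
      using interval by (simp add: daubechies_basis_interval_def)
    show "continuous_on {0..1} (phi W k)" if "k \<in> phi_index W" for k
      using Phi_cont[of "coarse W" k] that by (simp add: W)
    show "continuous_on {0..1} (psi W l k)" if "coarse W \<le> l" "k \<in> psi_index W l" for l k
      using Psi_cont[of l k] that by (simp add: W)
    show "finite {k \<in> phi_index W. \<exists>x\<in>{0..1}. \<bar>x\<bar> \<le> r \<and> phi W k x \<noteq> 0}" for r
      by (rule finite_subset[of _ "{1..2 ^ coarse W}"]) (auto simp: W)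
    show "finite {k \<in> psi_index W l. \<exists>x\<in>{0..1}. \<bar>x\<bar> \<le> r \<and> psi W l k x \<noteq> 0}" for l r
      by (rule finite_subset[of _ "{1..2 ^ l}"]) (auto simp: W)
    show "\<bar>psi W l k x\<bar> \<le> C * 2 powr (real l / 2)"
      if "coarse W \<le> l" "k \<in> psi_index W l" "x \<in> {0..1}" for l k x
      using C(2)[OF that(1) _ that(3), of k] that(2) by (simp add: W)
    show "card {k \<in> psi_index W l. psi W l k x \<noteq> 0} \<le> 4 * p + 1" if "coarse W \<le> l" for l x
      using Psi_card[OF that, of x] by (simp add: W)
    show "\<exists>a. \<forall>x\<in>{0..1}. psi W l k x \<noteq> 0 \<longrightarrow> x \<in> {a..a + 2 * real p / 2 ^ l}"
      if "coarse W \<le> l" "k \<in> psi_index W l" for l k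
      using Psi_support[OF that(1), of k] that(2) by (simp add: W)
  qed (use C p in auto)
  then show thesis by (rule that)
qed

lemma separated_density_interval:
  fixes B s t :: real
  assumes interval: "daubechies_basis_interval S W" and S: "0 < S"
    and s: "0 < s" "s < t" and B: "1 \<le> B"
  obtains f \<rho> where "0 < \<rho>" "f \<in> Sigma_class {0..1} W B s"
    "\<And>g. g \<in> Sigma_class {0..1} W B t \<Longrightarrow> ereal \<rho> \<le> sup_norm {0..1} (\<lambda>x. g x - f x)"
    "\<And>m \<epsilon>. 0 < \<epsilon> \<Longrightarrow> f \<notin> Sigma_bar {0..1} W B \<epsilon> s m"
proof -
  obtain C D N where "localised_wavelets {0..1} W C D N"
    using localised_wavelets_interval[OF interval S] .
  then interpret localised_wavelets "{0..1}" W C D N .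
  obtain p \<phi> \<psi> \<phi>L \<phi>R \<psi>L \<psi>R where bc: "boundary_corrected S p \<phi> \<psi> \<phi>L \<phi>R \<psi>L \<psi>R (coarse W)"
    and W: "phi_index W = {1..2 ^ coarse W}" "phi W = interval_family p \<phi>L \<phi> \<phi>R (coarse W)"
    "psi_index W = (\<lambda>l. {1..2 ^ l})" "psi W = interval_family p \<psi>L \<psi> \<psi>R"
    using daubechies_basis_intervalE[OF interval S] .
  interpret b: boundary_corrected S p \<phi> \<psi> \<phi>L \<phi>R \<psi>L \<psi>R "coarse W" by (rule bc)
  have one: "set_integrable lborel {0..1::real} (\<lambda>x. 1 :: real)" "(LINT x:{0..1::real}|lborel. 1) = (1 :: real)"
    by (simp_all add: set_integrable_def set_lebesgue_integral_def)
  have bdd: "bounded ((\<lambda>_. 1 :: real) ` {0..1::real})"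
    by (rule finite_imp_bounded, rule finite_subset[of _ "{1}"]) auto
  have psi_int: "(LINT x:{0..1}|lborel. psi W l k x) = 0"
    if "coarse W \<le> l" "k \<in> psi_index W l" for l k
    using b.Psi_mean[OF that(1), of k] that(2) by (simp add: W)
  show thesis
  proof (rule terminating_density_separated[where B = B and s = s and t = t and \<mu> = 1 and f\<^sub>0 = "\<lambda>_. 1"])
    show "bounded ((\<lambda>_. 1 :: real) ` {0..1::real})" by (rule bdd)
    show "\<bar>alpha {0..1} W k (\<lambda>_. 1)\<bar> \<le> 1" if k: "k \<in> phi_index W" for k
    proof -
      have l2: "set_integrable lborel {0..1} (\<lambda>x. (phi W k x)\<^sup>2)"
        using phi_l2[OF k] by (simp add: l2_function_def)
      have prod: "set_integrable lborel {0..1} (phi W k)"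
        using set_integrable_times_l2[of "\<lambda>_. 1", OF continuous_on_const bdd one(1) phi_l2[OF k]] by simp
      have norm: "(LINT x:{0..1}|lborel. (phi W k x)\<^sup>2) = 1"
      proof -
        have mem: "Inl k \<in> wavelet_indices W" using k by simp
        have "l2_inner {0..1} (wavelet_family W (Inl k)) (wavelet_family W (Inl k)) = 1"
          using orthonormal mem by (simp add: orthonormal_family_def)
        then show ?thesis
          by (simp add: l2_inner_def wavelet_family_def power2_eq_square)
      qed
      have "\<bar>LINT x:{0..1}|lborel. phi W k x\<bar> \<le> (LINT x:{0..1}|lborel. \<bar>phi W k x\<bar>)"
        unfolding set_lebesgue_integral_def
        by (rule order_trans[OF integral_abs_bound]) (simp add: abs_mult)
      \<comment> \<open>On an interval of length 1, |z| \<le> (1 + z^2) / 2 bounds the L^1 norm of a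
        normalised function by 1.\<close>
      also have "\<dots> \<le> (LINT x:{0..1}|lborel. (1 + (phi W k x)\<^sup>2) / 2)"
      proof (intro set_integral_mono set_integrable_abs prod set_integrable_divide set_integral_add(1) one l2)
        fix x
        show "\<bar>phi W k x\<bar> \<le> (1 + (phi W k x)\<^sup>2) / 2"
          using sum_squares_bound[of 1 "\<bar>phi W k x\<bar>"] by simp
      qed
      also have "\<dots> = ((LINT x:{0..1::real}|lborel. 1) + (LINT x:{0..1}|lborel. (phi W k x)\<^sup>2)) / 2"
        using set_integral_add(2)[OF one(1) l2] by simp
      also have "\<dots> = 1" by (simp only: one norm) simp
      finally show ?thesis by (simp add: alpha_def)
    qed
    show "beta {0..1} W l k (\<lambda>_. 1) = 0" if "coarse W \<le> l" "k \<in> psi_index W l" for l k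
      using psi_int[OF that] by (simp add: beta_def)
    show "\<exists>k\<in>psi_index W l. \<forall>x\<in>{0..1}. psi W l k x \<noteq> 0 \<longrightarrow> (1::real) \<le> 1" for l
      by (intro bexI[of _ 1]) (auto simp: W)
  qed (use s B psi_int one that in auto)
qed

section \<open>Both domains together\<close>

lemma localised_wavelets_daubechies:
  assumes "daubechies_wavelet_basis T S W" "0 < S"
  obtains C D N where "localised_wavelets T W C D N"
  using assms(1) unfolding daubechies_wavelet_basis_def
proof (elim disjE conjE)
  assume T: "T = {0..1}" and "daubechies_basis_interval S W"
  then show thesis
    using localised_wavelets_interval[OF _ assms(2)] that unfolding T by blast
next
  assume T: "T = UNIV" and "daubechies_basis_line S W"
  then show thesis
    using localised_wavelets_line[OF _ assms(2)] that unfolding T by blast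
qed

lemma separated_density_daubechies:
  fixes B s t :: real
  assumes basis: "daubechies_wavelet_basis T S W" and S: "0 < S"
    and s: "0 < s" "s < t" and B: "1 \<le> B"
  obtains f \<rho> where "0 < \<rho>" "f \<in> Sigma_class T W B s"
    "\<And>g. g \<in> Sigma_class T W B t \<Longrightarrow> ereal \<rho> \<le> sup_norm T (\<lambda>x. g x - f x)"
    "\<And>m \<epsilon>. 0 < \<epsilon> \<Longrightarrow> f \<notin> Sigma_bar T W B \<epsilon> s m"
  using basis unfolding daubechies_wavelet_basis_def
proof (elim disjE conjE)
  assume T: "T = {0..1}" and i: "daubechies_basis_interval S W"
  show thesis
    by (rule separated_density_interval[OF i S s B], rule that[unfolded T])
next
  assume T: "T = UNIV" and l: "daubechies_basis_line S W"
  show thesis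
    by (rule separated_density_line[OF l S s B], rule that[unfolded T])
qed

section \<open>The minimax rate\<close>

lemma rate_pos: "2 \<le> n \<Longrightarrow> 0 < rate s n"
  by (simp add: rate_def)

lemma rate_tendsto_0:
  assumes "0 < s"
  shows "rate s \<longlonglongrightarrow> 0"
proof -
  define e where "e = s / (2 * s + 1)"
  have "0 < e" using assms by (simp add: e_def)
  then have "(\<lambda>n. (ln (real n) / real n) powr e) \<longlonglongrightarrow> 0"
    by real_asymp
  then show ?thesis by (simp add: rate_def[abs_def] e_def)
qed

lemma dominates_rate_eventually:
  assumes "dominates_rate s lev" "0 < c"
  shows "\<exists>n\<^sub>0. \<forall>n\<ge>n\<^sub>0. L * rate s n \<le> c * 2 powr (- real (lev n) * s)"
proof -
  have "\<forall>\<^sub>F n in sequentially. L / c \<le> 2 powr (- real (lev n) * s) / rate s n"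
    using assms(1) unfolding dominates_rate_def filterlim_at_top by blast
  then have "\<forall>\<^sub>F n in sequentially. L * rate s n \<le> c * 2 powr (- real (lev n) * s)"
    using eventually_ge_at_top[of 2]
  proof eventually_elim
    case (elim n)
    then show ?case
      using rate_pos[OF elim(2), of s] assms(2) by (simp add: field_simps)
  qed
  then show ?thesis by (simp add: eventually_sequentially)
qed

text \<open>With y = n / ln n, the bound 2^lev \<le> c y^(1/(2R+1)) makes 2^(-lev s) at least c^(-s)
  y^(-s/(2R+1)), while the rate is y^(-s/(2s+1)). The quotient is at least a constant times y^e, and
  e > 0 because R > s.\<close>

lemma dominates_rate_of_smoother_level:
  fixes s R :: real
  assumes s: "0 < s" and R: "s < R"
    and lev: "(\<lambda>n. 2 ^ lev n) \<in> \<Theta>(\<lambda>n. (real n / ln (real n)) powr (1 / (2 * R + 1)))"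
  shows "dominates_rate s lev"
proof -
  have "(\<lambda>n. 2 ^ lev n :: real) \<in> O(\<lambda>n. (real n / ln (real n)) powr (1 / (2 * R + 1)))"
    using lev by (rule bigthetaD1)
  then obtain c where c: "0 < c"
    "\<forall>\<^sub>F n in sequentially. norm (2 ^ lev n :: real) \<le> c * norm ((real n / ln (real n)) powr (1 / (2 * R + 1)))"
    by (rule landau_o.bigE)
  define e where "e = s / (2 * s + 1) - s / (2 * R + 1)"
  have e: "0 < e"
    using s R by (simp add: e_def frac_less2)
  have "filterlim (\<lambda>n::nat. c powr (- s) * (real n / ln (real n)) powr e) at_top sequentially"
    using c(1) e by real_asymp
  then show ?thesis
    unfolding dominates_rate_def
  proof (rule filterlim_at_top_mono)
    show "\<forall>\<^sub>F n in sequentially. c powr (- s) * (real n / ln (real n)) powr e \<le>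
        2 powr (- real (lev n) * s) / rate s n"
      using c(2) eventually_ge_at_top[of 2]
    proof eventually_elim
      case (elim n)
      define y where "y = real n / ln (real n)"
      have y: "0 < y" using elim(2) by (simp add: y_def)
      have rate: "rate s n = y powr (- (s / (2 * s + 1)))"
      proof -
        have "ln (real n) / real n = inverse y" by (simp add: y_def)
        then show ?thesis using y by (simp add: rate_def powr_minus inverse_powr)
      qed
      have "2 powr real (lev n) \<le> c * y powr (1 / (2 * R + 1))"
        using elim(1) by (simp add: y_def powr_realpow)
      then have "(c * y powr (1 / (2 * R + 1))) powr (- s) \<le> (2 powr real (lev n)) powr (- s)"
        using s by (intro powr_mono2') auto
      also have "\<dots> = 2 powr (- real (lev n) * s)"
        by (simp add: powr_powr)
      finally have "(c * y powr (1 / (2 * R + 1))) powr (- s) / rate s n \<le> 2 powr (- real (lev n) * s) / rate s n"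
        using rate_pos[OF elim(2), of s] by (intro divide_right_mono) auto
      moreover have "(c * y powr (1 / (2 * R + 1))) powr (- s) / rate s n = c powr (- s) * y powr e"
      proof -
        have "(c * y powr (1 / (2 * R + 1))) powr (- s) = c powr (- s) * y powr (- (s / (2 * R + 1)))"
          using c(1) y by (simp add: powr_mult powr_powr)
        moreover have "y powr (- (s / (2 * R + 1))) / rate s n = y powr e"
          unfolding rate using y by (simp add: powr_diff[symmetric] e_def)
        ultimately show ?thesis by (simp only: times_divide_eq_right[symmetric])
      qed
      ultimately show ?case by (simp add: y_def)
    qed
  qed
qed

theorem proposition3:
  fixes T :: "real set" and W :: wavelet_system and S :: nat and s t B :: real
  assumes basis: "daubechies_wavelet_basis T S W"
    and s_pos: "0 < s" and s_less_t: "s < t" and t_less_S: "t < real S"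
    and B_ge_1: "1 \<le> B"
  shows
    "(\<forall>\<epsilon>>0. \<exists>c>0. \<forall>lev :: nat \<Rightarrow> nat. (\<forall>n. 0 < lev n) \<longrightarrow>
        (\<forall>n. \<forall>f \<in> Sigma_bar T W B \<epsilon> s (lev n).
           (INF g\<in>Sigma_class T W B t. sup_norm T (\<lambda>x. f x - g x))
             \<ge> ereal (c * 2 powr (- real (lev n) * s)))) \<and>
     (\<forall>\<epsilon>>0. \<forall>lev :: nat \<Rightarrow> nat. (\<forall>n. 0 < lev n) \<longrightarrow> dominates_rate s lev \<longrightarrow>
        (\<forall>L\<^sub>0>0. \<exists>n\<^sub>0. \<forall>n\<ge>n\<^sub>0.
           Sigma_bar T W B \<epsilon> s (lev n) \<subseteq> Sigma_tilde T W B t s (L\<^sub>0 * rate s n))) \<and>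
     (\<forall>L\<^sub>0'>0. \<exists>n\<^sub>0. \<forall>lev :: nat \<Rightarrow> nat. (\<forall>n. 0 < lev n) \<longrightarrow> dominates_rate s lev \<longrightarrow>
        (\<forall>\<epsilon>>0. \<forall>n\<ge>n\<^sub>0.
           Sigma_tilde T W B t s (L\<^sub>0' * rate s n) - Sigma_bar T W B \<epsilon> s (lev n) \<noteq> {})) \<and>
     (\<forall>lev :: nat \<Rightarrow> nat. \<forall>R>s. (\<forall>n. 0 < lev n) \<longrightarrow>
        (\<lambda>n. 2 ^ lev n) \<in> \<Theta>(\<lambda>n. (real n / ln (real n)) powr (1 / (2 * R + 1))) \<longrightarrow>
        dominates_rate s lev)"
proof (intro conjI)
  note wavelets = basis
  have S: "0 < S" using s_pos s_less_t t_less_S by (cases S) auto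
  obtain C D N where "localised_wavelets T W C D N"
    using localised_wavelets_daubechies[OF basis S] .
  then interpret localised_wavelets T W C D N .
  have B: "0 < B" using B_ge_1 by simp
  show "\<forall>\<epsilon>>0. \<exists>c>0. \<forall>lev :: nat \<Rightarrow> nat. (\<forall>n. 0 < lev n) \<longrightarrow>
        (\<forall>n. \<forall>f \<in> Sigma_bar T W B \<epsilon> s (lev n).
           (INF g\<in>Sigma_class T W B t. sup_norm T (\<lambda>x. f x - g x))
             \<ge> ereal (c * 2 powr (- real (lev n) * s)))"
  proof (intro allI impI)
    fix \<epsilon> :: real assume "0 < \<epsilon>"
    then obtain c where "0 < c" "\<And>m f g. f \<in> Sigma_bar T W B \<epsilon> s m \<Longrightarrow> g \<in> Sigma_class T W B t \<Longrightarrow>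
       ereal (c * 2 powr (- real m * s)) \<le> sup_norm T (\<lambda>x. f x - g x)"
      using Sigma_bar_separated[OF s_pos s_less_t B] by blast
    then show "\<exists>c>0. \<forall>lev :: nat \<Rightarrow> nat. (\<forall>n. 0 < lev n) \<longrightarrow>
        (\<forall>n. \<forall>f \<in> Sigma_bar T W B \<epsilon> s (lev n).
           (INF g\<in>Sigma_class T W B t. sup_norm T (\<lambda>x. f x - g x))
             \<ge> ereal (c * 2 powr (- real (lev n) * s)))"
      by (intro exI[of _ c] conjI allI impI ballI INF_greatest) auto
  qed
  show "\<forall>\<epsilon>>0. \<forall>lev :: nat \<Rightarrow> nat. (\<forall>n. 0 < lev n) \<longrightarrow> dominates_rate s lev \<longrightarrow>
        (\<forall>L\<^sub>0>0. \<exists>n\<^sub>0. \<forall>n\<ge>n\<^sub>0.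
           Sigma_bar T W B \<epsilon> s (lev n) \<subseteq> Sigma_tilde T W B t s (L\<^sub>0 * rate s n))"
  proof (intro allI impI)
    fix \<epsilon> L\<^sub>0 :: real and lev :: "nat \<Rightarrow> nat"
    assume "0 < \<epsilon>" and dom: "dominates_rate s lev"
    then obtain c where c: "0 < c" "\<And>m f g. f \<in> Sigma_bar T W B \<epsilon> s m \<Longrightarrow> g \<in> Sigma_class T W B t \<Longrightarrow>
       ereal (c * 2 powr (- real m * s)) \<le> sup_norm T (\<lambda>x. f x - g x)"
      using Sigma_bar_separated[OF s_pos s_less_t B] by blast
    obtain n\<^sub>0 where n0: "\<And>n. n\<^sub>0 \<le> n \<Longrightarrow> L\<^sub>0 * rate s n \<le> c * 2 powr (- real (lev n) * s)"
      using dominates_rate_eventually[OF dom c(1)] by blast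
    have "Sigma_bar T W B \<epsilon> s (lev n) \<subseteq> Sigma_tilde T W B t s (L\<^sub>0 * rate s n)" if "n\<^sub>0 \<le> n" for n
    proof
      fix f assume f: "f \<in> Sigma_bar T W B \<epsilon> s (lev n)"
      have "ereal (L\<^sub>0 * rate s n) \<le> sup_norm T (\<lambda>x. g x - f x)" if g: "g \<in> Sigma_class T W B t" for g
      proof -
        have "ereal (L\<^sub>0 * rate s n) \<le> ereal (c * 2 powr (- real (lev n) * s))"
          using n0[OF \<open>n\<^sub>0 \<le> n\<close>] by simp
        also have "\<dots> \<le> sup_norm T (\<lambda>x. f x - g x)"
          by (rule c(2)[OF f g])
        also have "\<dots> = sup_norm T (\<lambda>x. g x - f x)"
          by (simp add: sup_norm_def abs_minus_commute)
        finally show ?thesis .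
      qed
      then show "f \<in> Sigma_tilde T W B t s (L\<^sub>0 * rate s n)"
        using f by (auto simp: Sigma_tilde_def Sigma_bar_def intro: INF_greatest)
    qed
    then show "\<exists>n\<^sub>0. \<forall>n\<ge>n\<^sub>0. Sigma_bar T W B \<epsilon> s (lev n) \<subseteq> Sigma_tilde T W B t s (L\<^sub>0 * rate s n)"
      by blast
  qed
  show "\<forall>L\<^sub>0'>0. \<exists>n\<^sub>0. \<forall>lev :: nat \<Rightarrow> nat. (\<forall>n. 0 < lev n) \<longrightarrow> dominates_rate s lev \<longrightarrow>
        (\<forall>\<epsilon>>0. \<forall>n\<ge>n\<^sub>0.
           Sigma_tilde T W B t s (L\<^sub>0' * rate s n) - Sigma_bar T W B \<epsilon> s (lev n) \<noteq> {})"
  proof (intro allI impI)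
    fix L :: real assume "0 < L"
    \<comment> \<open>Neither \<open>f\<close> nor \<rho> depends on n, on the levels or on
      \<epsilon>; this is why the threshold can be chosen before \<open>lev\<close> and
      \<epsilon>.\<close>
    obtain f \<rho> where f: "0 < \<rho>" "f \<in> Sigma_class T W B s"
      "\<And>g. g \<in> Sigma_class T W B t \<Longrightarrow> ereal \<rho> \<le> sup_norm T (\<lambda>x. g x - f x)"
      "\<And>m \<epsilon>. 0 < \<epsilon> \<Longrightarrow> f \<notin> Sigma_bar T W B \<epsilon> s m"
      by (rule separated_density_daubechies[OF wavelets S s_pos s_less_t B_ge_1], rule that)
    have "(\<lambda>n. L * rate s n) \<longlonglongrightarrow> 0"
      by (intro tendsto_mult_right_zero rate_tendsto_0 s_pos)
    then have "\<forall>\<^sub>F n in sequentially. L * rate s n < \<rho>"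
      using f(1) by (rule order_tendstoD)
    then obtain n\<^sub>0 where n0: "\<And>n. n\<^sub>0 \<le> n \<Longrightarrow> L * rate s n < \<rho>"
      by (auto simp: eventually_sequentially)
    have "f \<in> Sigma_tilde T W B t s (L * rate s n)" if "n\<^sub>0 \<le> n" for n
    proof -
      have "ereal (L * rate s n) \<le> sup_norm T (\<lambda>x. g x - f x)" if "g \<in> Sigma_class T W B t" for g
        by (rule order_trans[OF _ f(3)[OF that]]) (use n0[OF \<open>n\<^sub>0 \<le> n\<close>] in simp)
      then show ?thesis
        using f(2) by (auto simp: Sigma_tilde_def intro: INF_greatest)
    qed
    then show "\<exists>n\<^sub>0. \<forall>lev :: nat \<Rightarrow> nat. (\<forall>n. 0 < lev n) \<longrightarrow> dominates_rate s lev \<longrightarrow>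
        (\<forall>\<epsilon>>0. \<forall>n\<ge>n\<^sub>0. Sigma_tilde T W B t s (L * rate s n) - Sigma_bar T W B \<epsilon> s (lev n) \<noteq> {})"
      using f(4) by blast
  qed
  show "\<forall>lev :: nat \<Rightarrow> nat. \<forall>R>s. (\<forall>n. 0 < lev n) \<longrightarrow>
        (\<lambda>n. 2 ^ lev n) \<in> \<Theta>(\<lambda>n. (real n / ln (real n)) powr (1 / (2 * R + 1))) \<longrightarrow>
        dominates_rate s lev"
    using dominates_rate_of_smoother_level[OF s_pos] by blast
qed

end
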